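(* Let $z,z'$ be real numbers with $z\le 0$ and $z'\le 0$. Then $$\int_0^1\zeta(z',q)\,\zeta(z,q)\,dq=\frac{2\,\Gamma(1-z)\Gamma(1-z')}{(2\pi)^{2-z-z'}}\,\zeta(2-z-z')\cos\Bigl(\frac{\pi(z-z')}{2}\Bigr)$$ $$=-\zeta(z+z'-1)\,B(1-z,1-z')\,\frac{\cos(\pi(z-z')/2)}{\cos(\pi(z+z')/2)}.$$ Similarly, $$\int_0^1\zeta(z',q)\,\zeta(z,1-q)\,dq=-\frac{2\,\Gamma(1-z)\Gamma(1-z')}{(2\pi)^{2-z-z'}}\,\zeta(2-z-z')\cos\Bigl(\frac{\pi(z+z')}{2}\Bigr)$$ $$=\zeta(z+z'-1)\,B(1-z,1-z').$$
   Context: $\zeta(z,q)$ denotes the Hurwitz zeta function: for $q>0$ it is $\sum_{n=0}^{\infty}(n+q)^{-z}$ when $\mathrm{Re}(z)>1$, extended by analytic continuation in $z$ to $\mathbb{C}\setminus\{1\}$. $\zeta(s)=\zeta(s,1)$ is the Riemann zeta function and $B(x,y)=\Gamma(x)\Gamma(y)/\Gamma(x+y)$ is the beta function. When $z+z'$ is an odd (negative) integer, $\zeta(z+z'-1)/\cos(\pi(z+z')/2)$ has the form $0/0$ and is interpreted by its limit (removable singularity in $z+z'$). *)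

theory Defs
  imports "HOL-Complex_Analysis.Complex_Analysis"
begin

text \<open>
  For \<open>q > 0\<close> the half-plane series has exactly one holomorphic extension to the (connected)
  punctured plane, so the description below determines the value for every \<open>s \<noteq> 1\<close>.
  At the pole \<open>s = 1\<close>, and for \<open>q \<le> 0\<close>, the value is not meant to be used.
\<close>

definition hurwitz_zeta :: "complex \<Rightarrow> real \<Rightarrow> complex" where
  "hurwitz_zeta s q =
     (THE w. \<exists>f. f holomorphic_on (- {1}) \<and>
                 (\<forall>z. Re z > 1 \<longrightarrow> f z = (\<Sum>n. complex_of_real (real n + q) powr (- z))) \<and>
                 w = f s)"

definition riemann_zeta :: "complex \<Rightarrow> complex" where
  "riemann_zeta s = hurwitz_zeta s 1"

text \<open>
  The quotient \<open>\<zeta>(w - 1) / cos (\<pi> w / 2)\<close>. At odd negative integers \<open>w\<close> it has the form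
  \<open>0 / 0\<close> and stands for its limit, which is what \<^const>\<open>remove_sings\<close> supplies; where the
  cosine does not vanish (and \<open>w \<noteq> 2\<close>) it is the ordinary quotient.
\<close>

definition zeta_over_cos :: "complex \<Rightarrow> complex" where
  "zeta_over_cos = remove_sings (\<lambda>w. riemann_zeta (w - 1) / cos (of_real pi * w / 2))"

end

theory Submission
  imports Defs "HOL-Real_Asymp.Real_Asymp"
begin

text \<open>
  For \<open>Re s > -1\<close> the trapezoidal rule continues the Hurwitz series, and for \<open>Re s < 0\<close> the Fourier
  series in Hurwitz's formula is holomorphic in \<open>s\<close>. The two agree for real \<open>s = -a\<close> with
  \<open>0 < a < 1\<close>, since as functions of \<open>q\<close> they are continuous, periodic and have the same Fourier
  coefficients: unfolding the sum over \<open>n\<close> turns those of the continuation into the oscillatory integral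
  \<open>\<integral> x\<^sup>a e\<^sup>-\<^sup>c\<^sup>x dx\<close> over \<open>[0,\<infinity>)\<close> with \<open>c\<close> imaginary. Hence the two glue to the analytic continuation and
  Hurwitz's formula holds for \<open>Re s < 0\<close>. Both integrals follow by integrating the uniformly convergent
  expansion of one factor against the Fourier coefficients of the other (for \<open>z = z' = 0\<close> the factors are
  linear), and the second form of each from the functional equation, which is Hurwitz's formula at \<open>q = 1\<close>.
\<close>

text \<open>Both bounds in 0 < a < 1 matter: a > 0 makes q^a continuous at 0, so that uniqueness for
  continuous periodic functions applies; a < 1 makes the trapezoidal errors summable and lets
  remainders of size N^(a-1) vanish. The integral of x^a e^(-cx) over the half-line does not
  converge literally: its truncation at an integer N carries the boundary term -N^a / c. The affine
  correction in \<open>hz_poly\<close> removes exactly this term and leaves the convergent integral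
  with exponent a - 1, whose value comes from turning the positive real ray onto the imaginary axis.
  For real z < 0, Hurwitz's formula is kept as one sine series, \<open>hz_const z\<close> times the
  sum of n^(z-1) sin(2 pi n q + pi z / 2). A product integral then sees only the difference of two
  phases. Replacing q by 1 - q changes a phase \<beta> into pi - \<beta>, which accounts for both z
  + z' and the minus sign in the second integral. At z = 0 the sine series is no longer absolutely
  convergent, so 1/2 - q enters through its Fourier coefficients instead.\<close>

section \<open>An oscillatory Gamma integral\<close>

text \<open>
  \<open>N\<^sup>a\<close> times \<open>igamma_series a (c N)\<close> is the integral of \<open>x\<^sup>a\<^sup>-\<^sup>1 e\<^sup>-\<^sup>c\<^sup>x\<close> over \<open>[0,N]\<close> for every complex \<open>c\<close>,
  which avoids branch cuts.
\<close>

definition igamma_coeff :: "real \<Rightarrow> nat \<Rightarrow> complex" where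
  "igamma_coeff a n = of_real ((-1) ^ n / (fact n * (a + real n)))"

definition igamma_series :: "real \<Rightarrow> complex \<Rightarrow> complex" where
  "igamma_series a w = (\<Sum>n. igamma_coeff a n * w ^ n)"

lemma summable_igamma_coeff:
  assumes "a > 0"
  shows "summable (\<lambda>n. igamma_coeff a n * w ^ n)"
proof (rule summable_comparison_test'[where N = 0])
  show "summable (\<lambda>n. (norm w ^ n /\<^sub>R fact n) / a)"
    using summable_exp_generic[of "norm w"] by (intro summable_divide) auto
  show "norm (igamma_coeff a n * w ^ n) \<le> (norm w ^ n /\<^sub>R fact n) / a" for n
    using assms
    by (auto simp: igamma_coeff_def norm_mult norm_power norm_divide divide_simps
             simp del: of_real_divide of_real_mult of_real_power)
       (auto simp: field_simps intro!: mult_left_mono)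
qed

text \<open>Since a + n times the n-th coefficient is (-1)^n / n!, the operator a + w d/dw sends the
  series to exp(-w). Hence w^a times the series is an antiderivative of w^(a-1) exp(-w), along the
  real axis as well as on the slit plane.\<close>

lemma igamma_series_ode:
  assumes "a > 0"
  shows "\<exists>D. (igamma_series a has_field_derivative D) (at w) \<and>
             of_real a * igamma_series a w + w * D = exp (-w)"
proof (intro exI conjI)
  define D where "D = (\<Sum>n. diffs (igamma_coeff a) n * w ^ n)"
  show "(igamma_series a has_field_derivative D) (at w)"
    unfolding igamma_series_def [abs_def] D_def
    by (rule termdiffs_strong_converges_everywhere) (rule summable_igamma_coeff[OF assms])
  have 1: "(\<lambda>n. of_real a * (igamma_coeff a n * w ^ n)) sums (of_real a * igamma_series a w)"
    unfolding igamma_series_def using summable_igamma_coeff[OF assms] by (intro sums_mult summable_sums)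
  have "(\<lambda>n. diffs (igamma_coeff a) n * w ^ n) sums D"
    unfolding D_def
    by (intro summable_sums termdiff_converges_all summable_igamma_coeff[OF assms])
  hence "(\<lambda>n. w * (diffs (igamma_coeff a) n * w ^ n)) sums (w * D)"
    by (rule sums_mult)
  hence "(\<lambda>n. of_nat (Suc n) * igamma_coeff a (Suc n) * w ^ Suc n) sums (w * D)"
    by (simp add: diffs_def mult_ac)
  hence 2: "(\<lambda>n. of_nat n * igamma_coeff a n * w ^ n) sums (w * D)"
    by (subst (asm) sums_Suc_iff) auto
  have "(\<lambda>n. of_real a * (igamma_coeff a n * w ^ n) + of_nat n * igamma_coeff a n * w ^ n)
          sums (of_real a * igamma_series a w + w * D)"
    by (rule sums_add[OF 1 2])
  also have "(\<lambda>n. of_real a * (igamma_coeff a n * w ^ n) + of_nat n * igamma_coeff a n * w ^ n)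
                = (\<lambda>n. (-w) ^ n /\<^sub>R fact n)"
  proof
    fix n
    have "of_real a * (igamma_coeff a n * w ^ n) + of_nat n * igamma_coeff a n * w ^ n
            = of_real (a + real n) * igamma_coeff a n * w ^ n"
      by (simp add: algebra_simps)
    also have "\<dots> = of_real ((a + real n) * ((-1) ^ n / (fact n * (a + real n)))) * w ^ n"
      by (simp only: igamma_coeff_def of_real_mult)
    also have "(a + real n) * ((-1) ^ n / (fact n * (a + real n))) = (-1) ^ n / fact n"
      using assms by (simp add: divide_simps)
    also have "of_real \<dots> * w ^ n = (-w) ^ n /\<^sub>R fact n"
      by (simp add: scaleR_conv_of_real power_minus[of w] field_simps)
    finally show "of_real a * (igamma_coeff a n * w ^ n) + of_nat n * igamma_coeff a n * w ^ n
                    = (-w) ^ n /\<^sub>R fact n" .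
  qed
  finally show "of_real a * igamma_series a w + w * D = exp (-w)"
    using exp_converges[of "-w"] sums_unique2 by blast
qed

lemma continuous_on_igamma_series [continuous_intros]:
  assumes "a > 0" "continuous_on A f"
  shows "continuous_on A (\<lambda>x. igamma_series a (f x))"
proof -
  have "continuous_on UNIV (igamma_series a)"
    using igamma_series_ode[OF assms(1)] DERIV_isCont by (metis continuous_at_imp_continuous_on)
  thus ?thesis using assms(2) by (rule continuous_on_compose2) auto
qed

lemma has_integral_powr_exp:
  fixes c :: complex
  assumes "a > 0" "N \<ge> 0"
  shows "((\<lambda>x. of_real (x powr (a - 1)) * exp (- c * of_real x)) has_integral
           of_real (N powr a) * igamma_series a (c * of_real N)) {0..N}"
proof -
  let ?F = "\<lambda>x. of_real (x powr a) * igamma_series a (c * of_real x)"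
  \<comment> \<open>For a < 1 the integrand is unbounded near 0, but \<open>?F\<close> is continuous
    there with value 0, so differentiability is required only in the interior.\<close>
  have "((\<lambda>x. of_real (x powr (a - 1)) * exp (- c * of_real x)) has_integral ?F N - ?F 0) {0..N}"
  proof (rule fundamental_theorem_of_calculus_interior)
    show "continuous_on {0..N} ?F"
      using assms by (intro continuous_intros continuous_on_powr') auto
    fix x assume x: "x \<in> {0<..<N}"
    obtain D where D: "(igamma_series a has_field_derivative D) (at (c * of_real x))"
      "of_real a * igamma_series a (c * of_real x) + (c * of_real x) * D = exp (- (c * of_real x))"
      using igamma_series_ode[OF assms(1)] by blast
    have g: "((\<lambda>x::real. igamma_series a (c * of_real x)) has_vector_derivative (c * D)) (at x)"
    proof -
      have "((\<lambda>x. c * of_real x) has_vector_derivative c) (at x)"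
        by (auto intro!: derivative_eq_intros)
      from field_vector_diff_chain_at[OF this, of "igamma_series a" D] D(1)
      show ?thesis by (simp add: o_def)
    qed
    have p: "((\<lambda>x. of_real (x powr a) :: complex) has_vector_derivative of_real (a * x powr (a - 1))) (at x)"
      using x by (intro has_vector_derivative_of_real) (auto intro!: derivative_eq_intros)
    have e: "x powr a = x powr (a - 1) * x"
      using x by (simp add: powr_diff)
    have "(?F has_vector_derivative
        (of_real (x powr a) * (c * D) + of_real (a * x powr (a - 1)) * igamma_series a (c * of_real x))) (at x)"
      by (rule has_vector_derivative_mult[OF p g])
    also have "of_real (x powr a) * (c * D) + of_real (a * x powr (a - 1)) * igamma_series a (c * of_real x)
        = of_real (x powr (a - 1)) * (of_real a * igamma_series a (c * of_real x) + (c * of_real x) * D)"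
      unfolding e by (simp add: algebra_simps)
    finally show "(?F has_vector_derivative (of_real (x powr (a - 1)) * exp (- c * of_real x))) (at x)"
      using D(2) by simp
  qed (use assms in auto)
  thus ?thesis by simp
qed

section \<open>The lower incomplete gamma function on the slit plane\<close>

definition igamma :: "real \<Rightarrow> complex \<Rightarrow> complex" where
  "igamma a w = w powr of_real a * igamma_series a w"

lemma igamma_has_field_derivative:
  assumes "a > 0" "w \<notin> \<real>\<^sub>\<le>\<^sub>0"
  shows "(igamma a has_field_derivative w powr (of_real (a - 1)) * exp (-w)) (at w)"
proof -
  obtain D where D: "(igamma_series a has_field_derivative D) (at w)"
    "of_real a * igamma_series a w + w * D = exp (- w)"
    using igamma_series_ode[OF assms(1)] by blast
  have e: "w powr (of_real a) = w powr (of_real (a - 1)) * w"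
    using assms by (auto simp: powr_diff)
  have "(igamma a has_field_derivative
          w powr (of_real a) * D + (of_real a * w powr (of_real a - 1)) * igamma_series a w) (at w)"
    unfolding igamma_def [abs_def]
    by (rule derivative_eq_intros D has_field_derivative_powr assms refl)+ (simp add: mult_ac)
  also have "w powr (of_real a) * D + (of_real a * w powr (of_real a - 1)) * igamma_series a w
      = w powr (of_real (a - 1)) * (of_real a * igamma_series a w + w * D)"
    unfolding e by (simp add: algebra_simps)
  finally show ?thesis using D(2) by simp
qed

text \<open>On the positive reals \<open>igamma a\<close> is the truncated Euler integral of
  Gamma.\<close>

lemma igamma_of_real_tendsto:
  assumes a: "a > 0"
  shows "((\<lambda>R. igamma a (of_real R)) \<longlongrightarrow> of_real (Gamma a)) at_top"
proof (rule tendstoI)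
  fix e :: real assume e: "e > 0"
  let ?f = "\<lambda>x. of_real (x powr (a - 1)) * exp (- 1 * of_real x) :: complex"
  have "((\<lambda>t. of_real (t powr (a - 1) / exp t)) has_integral (of_real (Gamma a) :: complex)) {0..}"
    by (rule has_integral_of_real[OF Gamma_integral_real[OF a]])
  also have "(\<lambda>t. of_real (t powr (a - 1) / exp t)) = ?f"
    by (simp add: exp_minus field_simps exp_of_real)
  finally have "(?f has_integral of_real (Gamma a)) {0..}" .
  then obtain B where B: "B > 0" "\<And>l u. ball 0 B \<subseteq> cbox l u \<Longrightarrow>
      norm (integral (cbox l u) (\<lambda>x. if x \<in> {0..} then ?f x else 0) - of_real (Gamma a)) < e"
    using e unfolding has_integral_alt' by blast
  have "dist (igamma a (of_real R)) (of_real (Gamma a)) < e" if R: "R \<ge> B" for R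
  proof -
    have "ball 0 B \<subseteq> cbox (-R) R" using R by (auto simp: dist_norm)
    from B(2)[OF this] have
      "norm (integral {-R..R} (\<lambda>x. if x \<in> {0..} then ?f x else 0) - of_real (Gamma a)) < e" by simp
    also have "integral {-R..R} (\<lambda>x. if x \<in> {0..} then ?f x else 0) = integral ({0..} \<inter> {-R..R}) ?f"
      by (rule integral_restrict_Int)
    also have "{0..} \<inter> {-R..R} = {0..R}" using R B by auto
    also have "integral {0..R} ?f = of_real (R powr a) * igamma_series a (1 * of_real R)"
      using R B a by (intro integral_unique has_integral_powr_exp) auto
    also have "\<dots> = igamma a (of_real R)"
      using R B by (simp add: igamma_def powr_of_real)
    finally show ?thesis by (simp add: dist_norm)
  qed
  thus "\<forall>\<^sub>F R in at_top. dist (igamma a (of_real R)) (of_real (Gamma a)) < e"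
    by (auto simp: eventually_at_top_linorder)
qed

text \<open>The ray is rotated without contour integrals, by bounding the increments of the
  antiderivative \<open>igamma a\<close>: horizontally from iy to R + iy, which costs at most
  |y|^(a-1) times the integral of exp(-t), then vertically from R + iy to R, which costs O(R^(a-1)
  exp(-R)) and vanishes as R grows.\<close>

lemma igamma_imaginary_bound:
  assumes a: "0 < a" "a < 1" and y: "y \<noteq> 0"
  shows "norm (of_real (Gamma a) - igamma a (\<i> * of_real y)) \<le> \<bar>y\<bar> powr (a - 1)"
proof -
  have 1: "norm (igamma a (Complex R y) - igamma a (\<i> * of_real y)) \<le> \<bar>y\<bar> powr (a - 1)" if R: "R > 0" for R
  proof -
    let ?g = "\<lambda>t. igamma a (Complex t y)"
    have nR: "Complex t y \<notin> \<real>\<^sub>\<le>\<^sub>0" for t using y by (auto simp: complex_nonpos_Reals_iff)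
    have der: "(?g has_vector_derivative (Complex t y) powr (of_real (a - 1)) * exp (- Complex t y)) (at t within X)" for t X
    proof -
      have "((\<lambda>t. Complex t y) has_vector_derivative 1) (at t)"
        unfolding Complex_eq by (auto intro!: derivative_eq_intros)
      from field_vector_diff_chain_at[OF this igamma_has_field_derivative[OF a(1) nR]]
      show ?thesis by (simp add: o_def has_vector_derivative_at_within)
    qed
    \<comment> \<open>Since a - 1 < 0 and t + iy has modulus at least |y|, the derivative is at most
      |y|^(a-1) exp(-t); the right-hand side is the increment of an antiderivative of this
      bound.\<close>
    have "norm (?g R - ?g 0) \<le> - (\<bar>y\<bar> powr (a - 1) * exp (-R)) - - (\<bar>y\<bar> powr (a - 1) * exp (-0))"
    proof (rule differentiable_bound_general[where
          f' = "\<lambda>t. (Complex t y) powr (of_real (a - 1)) * exp (- Complex t y)"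
          and \<phi>' = "\<lambda>t. \<bar>y\<bar> powr (a - 1) * exp (-t)"])
      show "continuous_on {0..R} ?g"
        by (rule continuous_on_vector_derivative) (rule der)
      show "continuous_on {0..R} (\<lambda>x. - (\<bar>y\<bar> powr (a - 1) * exp (- x)))"
        by (intro continuous_intros)
      fix x assume x: "0 < x" "x < R"
      show "((\<lambda>x. - (\<bar>y\<bar> powr (a - 1) * exp (- x))) has_vector_derivative \<bar>y\<bar> powr (a - 1) * exp (- x)) (at x)"
        by (auto intro!: derivative_eq_intros simp flip: has_real_derivative_iff_has_vector_derivative)
      show "(?g has_vector_derivative (Complex x y) powr (of_real (a - 1)) * exp (- Complex x y)) (at x)"
        by (rule der)
      have "norm (Complex x y powr of_real (a - 1)) = norm (Complex x y) powr (a - 1)"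
        by (subst norm_powr_real_powr') auto
      also have "\<dots> \<le> \<bar>y\<bar> powr (a - 1)"
        using a y abs_Im_le_cmod[of "Complex x y"] by (intro powr_mono2') auto
      finally show "norm (Complex x y powr of_real (a - 1) * exp (- Complex x y)) \<le> \<bar>y\<bar> powr (a - 1) * exp (- x)"
        by (simp add: norm_mult mult_right_mono)
    qed (use R in auto)
    also have "\<dots> \<le> \<bar>y\<bar> powr (a - 1)" by simp
    also have "Complex 0 y = \<i> * of_real y" by (simp add: complex_eq_iff)
    finally show ?thesis .
  qed
  have 2: "norm (igamma a (of_real R) - igamma a (Complex R y)) \<le> R powr (a - 1) * exp (-R) * \<bar>y\<bar>" if R: "R > 0" for R
  proof -
    let ?S = "{z. Re z = R}"
    have "norm (igamma a (of_real R) - igamma a (Complex R y)) \<le> R powr (a - 1) * exp (-R) * norm (of_real R - Complex R y)"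
    proof (rule field_differentiable_bound[where S = ?S and f' = "\<lambda>z. z powr of_real (a - 1) * exp (-z)"])
      have "?S = {z. (1::complex) \<bullet> z = R}" by (simp add: inner_complex_def)
      thus "convex ?S" by (simp only: convex_hyperplane)
      fix z assume z: "z \<in> ?S"
      have "z \<notin> \<real>\<^sub>\<le>\<^sub>0" using z R by (auto simp: complex_nonpos_Reals_iff)
      thus "(igamma a has_field_derivative z powr of_real (a - 1) * exp (- z)) (at z within ?S)"
        by (intro has_field_derivative_at_within[OF igamma_has_field_derivative] a)
      have "norm (z powr of_real (a - 1)) = norm z powr (a - 1)"
        by (subst norm_powr_real_powr') auto
      also have "\<dots> \<le> R powr (a - 1)"
        using a z R abs_Re_le_cmod[of z] by (intro powr_mono2') auto
      finally show "norm (z powr of_real (a - 1) * exp (- z)) \<le> R powr (a - 1) * exp (- R)"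
        using z by (simp add: norm_mult mult_right_mono)
    qed auto
    also have "of_real R - Complex R y = - (\<i> * of_real y)" by (simp add: complex_eq_iff)
    finally show ?thesis by (simp add: norm_mult)
  qed
  have lim: "((\<lambda>R. R powr (a - 1) * exp (-R) * \<bar>y\<bar> + \<bar>y\<bar> powr (a - 1)) \<longlongrightarrow> 0 * \<bar>y\<bar> + \<bar>y\<bar> powr (a - 1)) at_top"
  proof (intro tendsto_intros)
    show "((\<lambda>R. R powr (a - 1) * exp (-R)) \<longlongrightarrow> 0) at_top" by real_asymp
  qed
  have "norm (of_real (Gamma a) - igamma a (\<i> * of_real y)) \<le> 0 * \<bar>y\<bar> + \<bar>y\<bar> powr (a - 1)"
  proof (rule tendsto_le[OF _ lim])
    show "((\<lambda>R. norm (igamma a (of_real R) - igamma a (\<i> * of_real y)))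
            \<longlongrightarrow> norm (of_real (Gamma a) - igamma a (\<i> * of_real y))) at_top"
      by (intro tendsto_intros igamma_of_real_tendsto a)
    show "\<forall>\<^sub>F R in at_top. norm (igamma a (of_real R) - igamma a (\<i> * of_real y))
              \<le> R powr (a - 1) * exp (-R) * \<bar>y\<bar> + \<bar>y\<bar> powr (a - 1)"
      using eventually_gt_at_top[of 0]
    proof eventually_elim
      case (elim R)
      show ?case using norm_triangle_le[OF add_mono[OF 2[OF elim] 1[OF elim]]] by simp
    qed
  qed auto
  thus ?thesis by simp
qed

lemma fourier_powr_tendsto:
  fixes u :: real
  assumes a: "0 < a" "a < 1" and l: "u \<noteq> 0"
  shows "((\<lambda>N. integral {0..N} (\<lambda>x. of_real (x powr (a - 1)) * exp (- (\<i> * of_real u) * of_real x)))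
           \<longlongrightarrow> of_real (Gamma a) * (\<i> * of_real u) powr (- of_real a)) at_top"
proof -
  define c where "c = \<i> * complex_of_real u"
  have c: "c \<noteq> 0" using l by (simp add: c_def)
  have "((\<lambda>N. igamma a (\<i> * of_real (u * N))) \<longlongrightarrow> of_real (Gamma a)) at_top"
  proof (rule Lim_null[THEN iffD2, OF Lim_null_comparison])
    show "\<forall>\<^sub>F N in at_top. norm (igamma a (\<i> * of_real (u * N)) - of_real (Gamma a)) \<le> (\<bar>u\<bar> * N) powr (a - 1)"
      using eventually_gt_at_top[of 0]
    proof eventually_elim
      case (elim N)
      thus ?case using igamma_imaginary_bound[OF a, of "u * N"] l
        by (simp add: norm_minus_commute abs_mult)
    qed
    have "\<bar>u\<bar> > 0" using l by simp
    thus "((\<lambda>N. (\<bar>u\<bar> * N) powr (a - 1)) \<longlongrightarrow> 0) at_top" using a by real_asymp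
  qed
  hence "((\<lambda>N. igamma a (\<i> * of_real (u * N)) * c powr (- of_real a)) \<longlongrightarrow> of_real (Gamma a) * c powr (- of_real a)) at_top"
    by (intro tendsto_intros)
  moreover have "\<forall>\<^sub>F N in at_top. igamma a (\<i> * of_real (u * N)) * c powr (- of_real a)
      = integral {0..N} (\<lambda>x. of_real (x powr (a - 1)) * exp (- c * of_real x))"
    using eventually_gt_at_top[of 0]
  proof eventually_elim
    case (elim N)
    have "integral {0..N} (\<lambda>x. of_real (x powr (a - 1)) * exp (- c * of_real x))
        = of_real (N powr a) * igamma_series a (c * of_real N)"
      using elim a by (intro integral_unique has_integral_powr_exp) auto
    also have "\<dots> = (of_real (N powr a) * c powr (of_real a)) * igamma_series a (c * of_real N) * c powr (- of_real a)"
      using c by (simp add: powr_minus)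
    \<comment> \<open>Principal powers are multiplicative here because the factor N is a positive
      real.\<close>
    also have "of_real (N powr a) * c powr (of_real a) = (of_real N * c) powr of_real a"
      using elim by (subst powr_times_real_left) (auto simp: powr_of_real)
    finally show ?case by (simp add: igamma_def c_def mult_ac)
  qed
  ultimately show ?thesis
    unfolding c_def by (rule Lim_transform_eventually)
qed

section \<open>Uniqueness of Fourier coefficients\<close>

definition fexp :: "int \<Rightarrow> real \<Rightarrow> complex" where
  "fexp k x = cis (2 * pi * of_int k * x)"

lemma fexp_0 [simp]: "fexp 0 x = 1"
  and fexp_at_0 [simp]: "fexp k 0 = 1"
  and norm_fexp [simp]: "norm (fexp k x) = 1"
  by (simp_all add: fexp_def)

lemma fexp_at_1 [simp]: "fexp k 1 = 1"
  by (simp add: fexp_def cis_multiple_2pi)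

lemma fexp_mult: "fexp j x * fexp k x = fexp (j + k) x"
  by (simp add: fexp_def cis_mult algebra_simps)

lemma continuous_on_fexp [continuous_intros]:
  "continuous_on A f \<Longrightarrow> continuous_on A (\<lambda>x. fexp k (f x))"
  unfolding fexp_def by (intro continuous_intros)

lemma fexp_eq_exp: "fexp k x = exp (\<i> * of_real (2 * pi * of_int k) * of_real x)"
  by (simp add: fexp_def cis_conv_exp mult_ac)

lemma has_integral_fexp:
  "(fexp k has_integral (if k = 0 then 1 else 0)) {0..1}"
proof (cases "k = 0")
  case True
  have "((\<lambda>x::real. 1::complex) has_integral 1) {0..1}"
    using has_integral_const_real[of "1::complex" 0 1] by simp
  moreover have "fexp 0 = (\<lambda>_. 1)" by (auto simp: fexp_def)
  ultimately show ?thesis using True by simp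
next
  case False
  let ?c = "\<i> * of_real (2 * pi * of_int k)"
  note e = fexp_eq_exp
  have "(fexp k has_integral exp (?c * of_real 1) / ?c - exp (?c * of_real 0) / ?c) {0..1}"
  proof (rule fundamental_theorem_of_calculus)
    fix x :: real
    have "((\<lambda>z. exp (?c * z) / ?c) has_field_derivative exp (?c * of_real x)) (at (of_real x))"
      using False by (auto intro!: derivative_eq_intros)
    thus "((\<lambda>x. exp (?c * of_real x) / ?c) has_vector_derivative fexp k x) (at x within {0..1})"
      unfolding e by (rule has_vector_derivative_real_field)
  qed simp
  also have "exp (?c * of_real 1) = fexp k 1" by (simp only: e)
  finally show ?thesis using False by simp
qed

lemma continuous_on_real_polynomial_fexp:
  assumes "real_polynomial_function p"
  shows "continuous_on A (\<lambda>x. p (fexp k x))"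
proof -
  have "continuous_on UNIV p"
    using assms by (intro continuous_on_polymonial_function) (simp only: real_polynomial_function_eq)
  thus ?thesis
    by (rule continuous_on_compose2) (auto intro: continuous_intros)
qed

text \<open>The extra factor \<open>h\<close>, together with all frequencies \<open>k\<close> in the
  hypothesis, makes the induction go through products: for p q the claim for p is used with q h in
  place of \<open>h\<close>. A linear p only shifts the frequency by 1 in both directions.\<close>

lemma fourier_orthogonal_poly:
  fixes f :: "real \<Rightarrow> real"
  assumes f: "continuous_on {0..1} f"
    and p: "real_polynomial_function (p :: complex \<Rightarrow> real)"
    and h: "continuous_on {0..1} h"
    and z: "\<And>k. ((\<lambda>x. of_real (f x) * h x * fexp k x) has_integral 0) {0..1}"
  shows "((\<lambda>x. of_real (f x) * (of_real (p (fexp 1 x)) * h x) * fexp k x) has_integral 0) {0..1}"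
  using p h z
proof (induction arbitrary: h k rule: real_polynomial_function.induct)
  case (linear p)
  interpret p: bounded_linear p by fact
  \<comment> \<open>A real-linear functional of z has the form \<alpha> z plus its conjugate, and on
    the circle the conjugate of \<open>fexp 1 x\<close> is \<open>fexp (-1) x\<close>.\<close>
  define \<alpha> where "\<alpha> = Complex (p 1 / 2) (- p \<i> / 2)"
  have p: "of_real (p (fexp 1 x)) = \<alpha> * fexp 1 x + cnj \<alpha> * fexp (-1) x" for x
  proof -
    have "fexp 1 x = Re (fexp 1 x) *\<^sub>R 1 + Im (fexp 1 x) *\<^sub>R \<i>"
      by (simp add: complex_eq_iff)
    hence "p (fexp 1 x) = Re (fexp 1 x) * p 1 + Im (fexp 1 x) * p \<i>"
      by (metis p.add p.scaleR real_scaleR_def)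
    thus ?thesis
      by (simp add: complex_eq_iff \<alpha>_def fexp_def)
  qed
  have "((\<lambda>x. \<alpha> * (of_real (f x) * h x * fexp (k + 1) x) + cnj \<alpha> * (of_real (f x) * h x * fexp (k - 1) x))
           has_integral \<alpha> * 0 + cnj \<alpha> * 0) {0..1}"
    by (intro has_integral_add has_integral_mult_right linear)
  also have "(\<lambda>x. \<alpha> * (of_real (f x) * h x * fexp (k + 1) x) + cnj \<alpha> * (of_real (f x) * h x * fexp (k - 1) x))
      = (\<lambda>x. of_real (f x) * (of_real (p (fexp 1 x)) * h x) * fexp k x)"
  proof
    fix x
    have "fexp (k + 1) x = fexp k x * fexp 1 x" "fexp (k - 1) x = fexp k x * fexp (-1) x"
      by (simp_all add: fexp_mult)
    thus "\<alpha> * (of_real (f x) * h x * fexp (k + 1) x) + cnj \<alpha> * (of_real (f x) * h x * fexp (k - 1) x)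
      = of_real (f x) * (of_real (p (fexp 1 x)) * h x) * fexp k x"
      unfolding p by (simp only: ring_distribs mult_ac)
  qed
  finally show ?case by simp
next
  case (const c)
  show ?case using has_integral_mult_right[OF const(2)[of k], of "of_real c"]
    by (simp add: mult_ac)
next
  case (add p q)
  show ?case using has_integral_add[OF add.IH(1)[OF add.prems, of k] add.IH(2)[OF add.prems, of k]]
    by (simp only: of_real_add ring_distribs add_0_right)
next
  case (mult p q)
  have cq: "continuous_on {0..1} (\<lambda>x. of_real (q (fexp 1 x)) * h x)"
    by (intro continuous_intros continuous_on_real_polynomial_fexp mult)
  show ?case
    using mult.IH(1)[OF cq mult.IH(2)[OF mult.prems], of k] by (simp only: of_real_mult mult.assoc)
qed

text \<open>Stone--Weierstrass on the circle, to which \<open>f\<close> descends because \<open>f 0 = f 1\<close>.\<close>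
lemma fourier_uniqueness_real:
  fixes f :: "real \<Rightarrow> real"
  assumes f: "continuous_on {0..1} f" "f 0 = f 1"
    and z: "\<And>k. ((\<lambda>x. of_real (f x) * fexp k x) has_integral 0) {0..1}"
    and x: "x \<in> {0..1}"
  shows "f x = 0"
proof -
  define F where "F = f \<circ> (\<lambda>z. Arg2pi z / (2 * pi))"
  \<comment> \<open>The constant homotopy suffices: the correspondence between loops and circle maps
    is used for the continuity of \<open>F\<close>, including at the jump of
    \<open>Arg2pi\<close>.\<close>
  have "homotopic_loops UNIV f f"
    using f by (simp add: homotopic_loops_refl path_def pathfinish_def pathstart_def)
  from homotopic_loops_imp_homotopic_circlemaps[OF this]
  have F: "continuous_on (sphere 0 1) F"
    using homotopic_with_imp_continuous unfolding F_def by blast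
  have Ff: "F (fexp 1 x) = f x" if x: "x \<in> {0..1}" for x
  proof (cases "x = 1")
    case True
    have "Arg2pi 1 = 0" by (rule Arg2pi_unique[of 1]) auto
    thus ?thesis using f True by (simp add: F_def)
  next
    case False
    have "Arg2pi (fexp 1 x) = 2 * pi * x"
      using x False by (intro Arg2pi_unique[of 1]) (auto simp: fexp_def cis_conv_exp)
    thus ?thesis by (simp add: F_def)
  qed
  have fi: "(\<lambda>x. f x ^ 2) integrable_on {0..1}"
    by (intro integrable_continuous_real continuous_intros f)
  obtain B where B: "\<And>x. x \<in> {0..1} \<Longrightarrow> \<bar>f x\<bar> \<le> B" "B > 0"
  proof -
    obtain B where "B > 0" "\<forall>y \<in> f ` {0..1}. norm y \<le> B"
      using compact_imp_bounded[OF compact_continuous_image[OF f(1) compact_Icc]]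
      unfolding bounded_pos by blast
    thus ?thesis using that[of B] by auto
  qed
  \<comment> \<open>As \<open>f\<close> is orthogonal to the approximating polynomial p, the
    integral of f^2 equals that of f (f - p), at most B (e / B).\<close>
  have "integral {0..1} (\<lambda>x. f x ^ 2) \<le> e" if e: "e > 0" for e
  proof -
    obtain p where p: "real_polynomial_function p" "\<And>z. z \<in> sphere 0 1 \<Longrightarrow> \<bar>F z - p z\<bar> < e / B"
      using Stone_Weierstrass_real_polynomial_function[OF _ F, of "e / B"] e B by auto
    have cp: "continuous_on {0..1} (\<lambda>x. p (fexp 1 x))"
      by (rule continuous_on_real_polynomial_fexp) fact
    have "((\<lambda>x. of_real (f x) * (of_real (p (fexp 1 x)) * 1) * fexp 0 x) has_integral 0) {0..1}"
    proof (rule fourier_orthogonal_poly[OF f(1) p(1)])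
      show "((\<lambda>x. of_real (f x) * 1 * fexp k x) has_integral 0) {0..1}" for k
        using z[of k] by (simp only: mult_1_right)
    qed (rule continuous_on_const)
    hence "((\<lambda>x. of_real (f x * p (fexp 1 x)) :: complex) has_integral 0) {0..1}"
      by (simp only: mult_1_right fexp_0 of_real_mult)
    from has_integral_linear[OF this bounded_linear_Re]
    have 0: "((\<lambda>x. f x * p (fexp 1 x)) has_integral 0) {0..1}"
      by (simp only: o_def Re_complex_of_real zero_complex.sel)
    have "integral {0..1} (\<lambda>x. f x ^ 2) = integral {0..1} (\<lambda>x. f x ^ 2 - f x * p (fexp 1 x))"
      using 0 fi by (subst integral_diff) (auto simp: has_integral_iff)
    also have "\<dots> \<le> integral {0..1} (\<lambda>x::real. e)"
    proof (rule integral_le)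
      show "(\<lambda>x. f x ^ 2 - f x * p (fexp 1 x)) integrable_on {0..1}"
        by (intro integrable_continuous_real continuous_intros f cp)
      fix x :: real assume x: "x \<in> {0..1}"
      have "f x ^ 2 - f x * p (fexp 1 x) = f x * (f x - p (fexp 1 x))"
        by (simp add: algebra_simps power2_eq_square)
      also have "\<dots> \<le> \<bar>f x\<bar> * \<bar>f x - p (fexp 1 x)\<bar>"
        by (metis abs_ge_self abs_mult)
      also have "\<dots> \<le> B * (e / B)"
        using B(1)[OF x] B(2) p(2)[of "fexp 1 x"] Ff[OF x] by (intro mult_mono) auto
      finally show "f x ^ 2 - f x * p (fexp 1 x) \<le> e" using B by simp
    qed auto
    finally show ?thesis by simp
  qed
  hence "integral {0..1} (\<lambda>x. f x ^ 2) \<le> 0" by (rule field_le_epsilon) simp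
  moreover have "integral {0..1} (\<lambda>x. f x ^ 2) \<ge> 0"
    by (rule integral_nonneg[OF fi]) auto
  ultimately have "integral {0..1} (\<lambda>x. f x ^ 2) = 0" by simp
  hence "((\<lambda>x. f x ^ 2) has_integral 0) {0..1}"
    using fi by (simp add: has_integral_iff)
  hence "f x ^ 2 = 0"
    using x by (intro has_integral_0_cbox_imp_0[where f = "\<lambda>x. f x ^ 2"]) (auto intro!: continuous_intros f)
  thus ?thesis by simp
qed

section \<open>Continuation by the trapezoidal rule\<close>

text \<open>
  The error of the trapezoidal rule for \<open>u\<^sup>-\<^sup>s\<close> on \<open>[x,x+1]\<close>; the kernel form shows that it is of order
  \<open>x\<^sup>-\<^sup>s\<^sup>-\<^sup>2\<close>, hence summable for \<open>Re s > -1\<close>.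
\<close>

definition trap_err :: "complex \<Rightarrow> real \<Rightarrow> complex" where
  "trap_err s x = (of_real x powr (-s) + of_real (x + 1) powr (-s)) / 2
                    - (of_real (x + 1) powr (1 - s) - of_real x powr (1 - s)) / (1 - s)"

lemma trap_err_has_integral:
  assumes x: "x > 0" and s: "s \<noteq> 1"
  shows "((\<lambda>v. s * (s + 1) / 2 * of_real (v * (1 - v)) * of_real (x + v) powr (-s - 2))
            has_integral trap_err s x) {0..1}"
proof -
  \<comment> \<open>Two integrations by parts against the Peano kernel v (1 - v) / 2 of the
    trapezoidal rule. At the endpoints the first term vanishes, the second gives the mean of the end
    values, the third the integral of u^(-s).\<close>
  let ?P = "\<lambda>z. - (s / 2 * (z * (1 - z))) * (of_real x + z) powr (-s - 1)
                 - (1 / 2 - z) * (of_real x + z) powr (-s) - (of_real x + z) powr (1 - s) / (1 - s)"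
  have "((\<lambda>v. s * (s + 1) / 2 * of_real (v * (1 - v)) * of_real (x + v) powr (-s - 2))
            has_integral ?P (of_real 1) - ?P (of_real 0)) {0..1}"
  proof (rule fundamental_theorem_of_calculus)
    fix v :: real assume v: "v \<in> {0..1}"
    have nR: "of_real x + of_real v \<notin> (\<real>\<^sub>\<le>\<^sub>0 :: complex set)"
      using x v by (auto simp: complex_nonpos_Reals_iff)
    define X where "X = of_real x + complex_of_real v"
    have d: "((\<lambda>z. (of_real x + z) powr c) has_field_derivative c * X powr (c - 1)) (at (of_real v))" for c
      unfolding X_def using nR by (auto intro!: derivative_eq_intros)
    have d1: "((\<lambda>z. - (s / 2 * (z * (1 - z)))) has_field_derivative - (s / 2 * (1 - 2 * of_real v))) (at (of_real v))"
      by (rule derivative_eq_intros refl)+ (simp add: algebra_simps)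
    have d2: "((\<lambda>z. (1 / 2 - z)) has_field_derivative -1) (at (complex_of_real v))"
      by (auto intro!: derivative_eq_intros)
    have "(?P has_field_derivative
            ((- (s / 2 * (of_real v * (1 - of_real v)))) * ((-s - 1) * X powr (-s - 1 - 1))
              + (- (s / 2 * (1 - 2 * of_real v))) * X powr (-s - 1))
          - ((1 / 2 - of_real v) * ((-s) * X powr (-s - 1)) + (-1) * X powr (-s))
          - (1 - s) * X powr (1 - s - 1) / (1 - s)) (at (of_real v))"
      using DERIV_diff[OF DERIV_diff[OF DERIV_mult'[OF d1 d[of "-s-1"]] DERIV_mult'[OF d2 d[of "-s"]]]
              DERIV_cdivide[OF d[of "1-s"]]] by (simp only: X_def)
    also have "(1 - s) * X powr (1 - s - 1) / (1 - s) = X powr (-s)"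
      using s by simp
    also have "((- (s / 2 * (of_real v * (1 - of_real v)))) * ((-s - 1) * X powr (-s - 1 - 1))
              + (- (s / 2 * (1 - 2 * of_real v))) * X powr (-s - 1))
          - ((1 / 2 - of_real v) * ((-s) * X powr (-s - 1)) + (-1) * X powr (-s)) - X powr (-s)
        = s * (s + 1) / 2 * (of_real v * (1 - of_real v)) * X powr (-s - 1 - 1)"
      by (simp add: field_simps)
    also have "-s - 1 - 1 = -s - 2" by simp
    also have "of_real v * (1 - of_real v) = complex_of_real (v * (1 - v))" by simp
    also have "X = of_real (x + v)" by (simp add: X_def)
    finally have "(?P has_field_derivative s * (s + 1) / 2 * of_real (v * (1 - v)) * of_real (x + v) powr (-s - 2)) (at (of_real v))" .
    thus "((\<lambda>v. ?P (of_real v)) has_vector_derivative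
            s * (s + 1) / 2 * of_real (v * (1 - v)) * of_real (x + v) powr (-s - 2)) (at v within {0..1})"
      by (rule has_vector_derivative_real_field)
  qed auto
  also have "?P (of_real 1) - ?P (of_real 0) = trap_err s x"
    by (simp add: trap_err_def add_divide_distrib diff_divide_distrib)
  finally show ?thesis .
qed

lemma norm_trap_err_le:
  assumes x: "x > 0" and s: "s \<noteq> 1" "Re s > -2"
  shows "norm (trap_err s x) \<le> norm s * (norm s + 1) * x powr (- Re s - 2)"
proof -
  have "norm (trap_err s x) \<le> norm s * (norm s + 1) * x powr (- Re s - 2) * measure lborel {0..1::real}"
  proof (rule has_integral_bound_real[OF _ _ trap_err_has_integral[OF x s(1)]])
    fix v :: real assume v: "v \<in> {0..1} - {}"
    have 1: "norm (of_real (x + v) powr (-s - 2)) \<le> x powr (- Re s - 2)"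
      using v x s by (subst norm_powr_real_powr) (auto intro!: powr_mono2')
    have "v * (1 - v) \<le> 1 * 1" using v by (intro mult_mono) auto
    hence 2: "norm (of_real (v * (1 - v)) :: complex) \<le> 1"
      using v by (subst norm_of_real) (auto simp: abs_mult)
    have 3: "norm (s * (s + 1) / 2) \<le> norm s * (norm s + 1)"
      using norm_triangle_ineq[of s 1] mult_left_mono[of "norm (s + 1)" "norm s + 1" "norm s"]
      by (simp add: norm_mult norm_divide) (smt (verit) mult_nonneg_nonneg norm_ge_zero)
    have "norm (s * (s + 1) / 2 * of_real (v * (1 - v)) * of_real (x + v) powr (-s - 2))
            \<le> (norm s * (norm s + 1)) * 1 * x powr (- Re s - 2)"
      using mult_mono[OF mult_mono[OF 3 2] 1] by (simp add: norm_mult)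
    thus "norm (s * (s + 1) / 2 * of_real (v * (1 - v)) * of_real (x + v) powr (-s - 2))
            \<le> norm s * (norm s + 1) * x powr (- Re s - 2)" by simp
  qed auto
  thus ?thesis by simp
qed

text \<open>The Euler-Maclaurin form of the Hurwitz series: the integral of u^(-s) from q to
  infinity, half of the first term, and the trapezoidal errors.\<close>

definition hz_right :: "complex \<Rightarrow> real \<Rightarrow> complex" where
  "hz_right s q = of_real q powr (1 - s) / (s - 1) + of_real q powr (-s) / 2
                    + (\<Sum>n. trap_err s (real n + q))"

text \<open>Uniformity is joint on purpose: in s it yields holomorphy, in q it yields continuity and
  the passage to the limit in Fourier coefficients.\<close>

lemma uniform_limit_trap_err:
  assumes "\<sigma> > -1"
  shows "uniform_limit ({s. s \<noteq> 1 \<and> Re s \<ge> \<sigma> \<and> norm s \<le> R} \<times> {0<..1})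
           (\<lambda>N (s, q). \<Sum>n<N. trap_err s (real n + q)) (\<lambda>(s, q). \<Sum>n. trap_err s (real n + q)) sequentially"
proof -
  have "uniform_limit ({s. s \<noteq> 1 \<and> Re s \<ge> \<sigma> \<and> norm s \<le> R} \<times> {0<..1})
           (\<lambda>N p. \<Sum>n<N. (case p of (s, q) \<Rightarrow> trap_err s (real n + q)))
           (\<lambda>p. \<Sum>n. (case p of (s, q) \<Rightarrow> trap_err s (real n + q))) sequentially"
  proof (rule Weierstrass_m_test_ev)
    show "summable (\<lambda>n. R * (R + 1) * real n powr (- \<sigma> - 2))"
      using assms by (intro summable_mult) (simp add: summable_real_powr_iff)
    \<comment> \<open>The bound can only hold eventually: at n = 0 the majorant is 0 by the
      convention for \<open>powr\<close>.\<close>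
    show "\<forall>\<^sub>F n in sequentially. \<forall>p\<in>{s. s \<noteq> 1 \<and> Re s \<ge> \<sigma> \<and> norm s \<le> R} \<times> {0<..1}.
            norm (case p of (s, q) \<Rightarrow> trap_err s (real n + q)) \<le> R * (R + 1) * real n powr (- \<sigma> - 2)"
      using eventually_gt_at_top[of 0]
    proof (eventually_elim, safe)
      fix n :: nat and s :: complex and q :: real
      assume n: "n > 0" and s: "s \<noteq> 1" "Re s \<ge> \<sigma>" "norm s \<le> R" and q: "q \<in> {0<..1}"
      have "norm (trap_err s (real n + q)) \<le> norm s * (norm s + 1) * (real n + q) powr (- Re s - 2)"
        using s q assms by (intro norm_trap_err_le) auto
      also have "\<dots> \<le> R * (R + 1) * real n powr (- \<sigma> - 2)"
      proof (intro mult_mono)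
        have "(real n + q) powr (- Re s - 2) \<le> real n powr (- Re s - 2)"
          using n q s assms by (intro powr_mono2') auto
        also have "\<dots> \<le> real n powr (- \<sigma> - 2)"
          using n s by (intro powr_mono) auto
        finally show "(real n + q) powr (- Re s - 2) \<le> real n powr (- \<sigma> - 2)" .
        show R0: "0 \<le> R" using s(3) norm_ge_zero[of s] by linarith
        show "0 \<le> R * (R + 1)" using R0 by simp
      qed (use s in auto)
      finally show "norm (trap_err s (real n + q)) \<le> R * (R + 1) * real n powr (- \<sigma> - 2)" .
    qed
  qed
  thus ?thesis by (simp add: case_prod_unfold)
qed

text \<open>Every interior value receives a half from each neighbouring interval, and the integrals
  telescope. The boundary terms at q are those that \<open>hz_right\<close> adds back.\<close>

lemma sum_trap_err:
  "(\<Sum>n<N. trap_err s (real n + q)) =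
     (\<Sum>n<N. of_real (real n + q) powr (-s)) + of_real (real N + q) powr (-s) / 2 + of_real (real N + q) powr (1 - s) / (s - 1)
       - of_real q powr (1 - s) / (s - 1) - of_real q powr (-s) / 2"
proof (induction N)
  case (Suc N)
  have "(A + B) / 2 - (C - D) / (1 - s) = A / 2 + B / 2 + C / (s - 1) - D / (s - 1)" for A B C D :: complex
    by (simp add: divide_simps) (simp add: algebra_simps)
  note e = this
  have "trap_err s (real N + q) = of_real (real N + q) powr (-s) / 2 + of_real (real (Suc N) + q) powr (-s) / 2
      + of_real (real (Suc N) + q) powr (1 - s) / (s - 1) - of_real (real N + q) powr (1 - s) / (s - 1)"
    unfolding trap_err_def e by (simp add: add_ac)
  thus ?case using Suc by simp
qed auto

lemma hz_right_partial:
  assumes "\<sigma> > -1"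
  shows "uniform_limit ({s. s \<noteq> 1 \<and> Re s \<ge> \<sigma> \<and> norm s \<le> R} \<times> {0<..1})
     (\<lambda>N (s, q). (\<Sum>n<N. of_real (real n + q) powr (-s)) + of_real (real N + q) powr (-s) / 2
             + of_real (real N + q) powr (1 - s) / (s - 1))
     (\<lambda>(s, q). hz_right s q) sequentially"
proof -
  let ?A = "{s. s \<noteq> 1 \<and> Re s \<ge> \<sigma> \<and> norm s \<le> R} \<times> {0<..1::real}"
  have "uniform_limit ?A
    (\<lambda>N p. (case p of (s, q) \<Rightarrow> of_real q powr (1 - s) / (s - 1) + of_real q powr (-s) / 2) +
            (case p of (s, q) \<Rightarrow> \<Sum>n<N. trap_err s (real n + q)))
    (\<lambda>p. (case p of (s, q) \<Rightarrow> of_real q powr (1 - s) / (s - 1) + of_real q powr (-s) / 2) +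
            (case p of (s, q) \<Rightarrow> \<Sum>n. trap_err s (real n + q))) sequentially"
    by (intro uniform_limit_add uniform_limit_const uniform_limit_trap_err assms)
  thus ?thesis
    by (simp add: case_prod_unfold hz_right_def sum_trap_err add_ac)
qed

lemma holomorphic_hz_right:
  assumes q: "q \<in> {0<..1}"
  shows "(\<lambda>s. hz_right s q) holomorphic_on ({s. Re s > -1} - {1})"
proof -
  let ?S = "{s. Re s > -1} - {1}"
  have op: "open ?S" by (intro open_Diff open_halfspace_Re_gt) auto
  have "(\<lambda>s. \<Sum>n. trap_err s (real n + q)) holomorphic_on ?S"
  proof (rule holomorphic_uniform_sequence[OF op])
    show "(\<lambda>s. \<Sum>n<N. trap_err s (real n + q)) holomorphic_on ?S" for N
      unfolding trap_err_def using q by (intro holomorphic_intros) (auto simp: add_eq_0_iff)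
    fix x assume x: "x \<in> ?S"
    then obtain d where d: "d > 0" "cball x d \<subseteq> ?S"
      using op open_contains_cball by blast
    \<comment> \<open>The leftmost point of the disc shows that Re x - d is still above -1, so it
      can serve as the lower bound for Re s on the whole disc.\<close>
    have "x - of_real d \<in> cball x d" using d by (simp add: dist_norm)
    hence "Re (x - of_real d) > -1" using d by blast
    hence d': "Re x - d > -1" by simp
    have "uniform_limit (cball x d) (\<lambda>N s. \<Sum>n<N. trap_err s (real n + q)) (\<lambda>s. \<Sum>n. trap_err s (real n + q)) sequentially"
    proof (rule uniform_limit_compose'[OF uniform_limit_trap_err[OF d', of "norm x + d"], where h = "\<lambda>s. (s, q)", unfolded prod.case])
      show "(\<lambda>s. (s, q)) \<in> cball x d \<rightarrow> {s. s \<noteq> 1 \<and> Re x - d \<le> Re s \<and> cmod s \<le> cmod x + d} \<times> {0<..1}"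
      proof safe
        fix s assume s: "s \<in> cball x d"
        show "Re x - d \<le> Re s"
          using s abs_Re_le_cmod[of "x - s"] by (simp add: dist_norm)
        show "cmod s \<le> cmod x + d"
          using s norm_triangle_ineq2[of s x] by (simp add: dist_norm norm_minus_commute)
      qed (use d q in auto)
    qed
    thus "\<exists>d>0. cball x d \<subseteq> ?S \<and> uniform_limit (cball x d) (\<lambda>N s. \<Sum>n<N. trap_err s (real n + q))
             (\<lambda>s. \<Sum>n. trap_err s (real n + q)) sequentially"
      using d by blast
  qed
  thus ?thesis
    unfolding hz_right_def using q by (intro holomorphic_intros) auto
qed

lemma hz_right_partial_tendsto:
  assumes "s \<noteq> 1" "Re s > -1" "q \<in> {0<..1}"
  shows "(\<lambda>N. (\<Sum>n<N. of_real (real n + q) powr (-s)) + of_real (real N + q) powr (-s) / 2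
             + of_real (real N + q) powr (1 - s) / (s - 1)) \<longlonglongrightarrow> hz_right s q"
  using tendsto_uniform_limitI[OF hz_right_partial[OF assms(2), of "norm s"], of "(s, q)"] assms by simp

lemma hz_right_sums:
  assumes "Re s > 1" "q \<in> {0<..1}"
  shows "(\<lambda>n. of_real (real n + q) powr (-s)) sums hz_right s q"
proof -
  have lim: "(\<lambda>N. of_real (real N + q) powr (-z)) \<longlonglongrightarrow> 0" if "Re z > 0" for z
  proof (rule tendsto_norm_zero_cancel)
    have "(\<lambda>N. (real N + q) powr (- Re z)) \<longlonglongrightarrow> 0" using that by real_asymp
    moreover have "norm (of_real (real N + q) powr (-z)) = (real N + q) powr (- Re z)" for N
      using assms by (subst norm_powr_real_powr) auto
    ultimately show "(\<lambda>N. norm (of_real (real N + q) powr (-z))) \<longlonglongrightarrow> 0" by simp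
  qed
  have "(\<lambda>N. ((\<Sum>n<N. of_real (real n + q) powr (-s)) + of_real (real N + q) powr (-s) / 2
             + of_real (real N + q) powr (1 - s) / (s - 1)) - of_real (real N + q) powr (-s) / 2
             - of_real (real N + q) powr (- (s - 1)) / (s - 1)) \<longlonglongrightarrow> hz_right s q - 0 / 2 - 0 / (s - 1)"
    using assms by (intro tendsto_intros hz_right_partial_tendsto lim) auto
  thus ?thesis by (simp add: sums_def)
qed

text \<open>The trapezoidal rule is exact for the constant u^0, so only the first two terms, -q and
  1/2, survive.\<close>

lemma hz_right_0:
  assumes "q > 0" shows "hz_right 0 q = 1 / 2 - of_real q"
proof -
  have "trap_err 0 x = 0" if "x > 0" for x
  proof -
    have "complex_of_real x \<noteq> 0" "complex_of_real (x + 1) \<noteq> 0"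
      using that by (simp_all del: of_real_add)
    hence "trap_err 0 x = (1 + 1) / 2 - (of_real (x + 1) - of_real x) / 1"
      unfolding trap_err_def by (simp del: of_real_add)
    thus ?thesis by simp
  qed
  hence "trap_err 0 (real n + q) = 0" for n
    using assms by (simp add: add_nonneg_pos)
  thus ?thesis using assms by (simp add: hz_right_def)
qed

section \<open>Fourier coefficients of the continuation\<close>

text \<open>
  Expanding \<open>(N + q)\<^sup>a / 2 - (N + q)\<^sup>a\<^sup>+\<^sup>1 / (a + 1)\<close> around \<open>N\<close> up to \<open>O(N\<^sup>a\<^sup>-\<^sup>1)\<close> leaves corrections that are
  affine in \<open>q\<close>, so the approximants stay exactly periodic.
\<close>

definition hz_poly :: "real \<Rightarrow> nat \<Rightarrow> real \<Rightarrow> real" where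
  "hz_poly a N q = (\<Sum>n<N. (real n + q) powr a) - real N powr (a + 1) / (a + 1) - real N powr a * (q - 1 / 2)"

text \<open>Moving q from 0 to 1 telescopes the sum to N^a - 0^a = N^a, which is also the increase
  of the affine term.\<close>

lemma hz_poly_periodic: "a > 0 \<Longrightarrow> hz_poly a N 1 = hz_poly a N 0"
proof -
  assume a: "a > 0"
  have "(\<Sum>n<N. (real n + 1) powr a - real n powr a) = real N powr a - real 0 powr a"
    using sum_lessThan_telescope[of "\<lambda>n. real n powr a" N] by (simp add: add_ac)
  thus ?thesis by (simp add: hz_poly_def sum_subtractf algebra_simps)
qed

lemma continuous_on_hz_poly [continuous_intros]:
  "a > 0 \<Longrightarrow> continuous_on {0..1} (hz_poly a N)"
  unfolding hz_poly_def by (intro continuous_intros continuous_on_powr') auto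

text \<open>The mean value theorem twice: the second remainder has the first one as its derivative
  in q, and a < 1 makes z^(a-1) decreasing.\<close>

lemma powr_taylor_bounds:
  fixes a N q :: real
  assumes a: "0 < a" "a < 1" and N: "N > 0" and q: "0 \<le> q" "q \<le> 1"
  shows "0 \<le> (N + q) powr a - N powr a" "(N + q) powr a - N powr a \<le> N powr (a - 1)"
    "0 \<le> (N + q) powr (a + 1) / (a + 1) - N powr (a + 1) / (a + 1) - N powr a * q"
    "(N + q) powr (a + 1) / (a + 1) - N powr (a + 1) / (a + 1) - N powr a * q \<le> N powr (a - 1)"
proof -
  have 1: "0 \<le> (N + t) powr a - N powr a \<and> (N + t) powr a - N powr a \<le> N powr (a - 1)"
    if t: "0 \<le> t" "t \<le> 1" for t
  proof (cases "t = 0")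
    case False
    have "\<exists>z>N. z < N + t \<and> (N + t) powr a - N powr a = (N + t - N) * (a * z powr (a - 1))"
      using t False N by (intro MVT2) (auto intro!: derivative_eq_intros)
    then obtain z where z: "z > N" "(N + t) powr a - N powr a = t * (a * z powr (a - 1))" by auto
    have "t * (a * z powr (a - 1)) \<le> 1 * (1 * N powr (a - 1))"
      using t a z N by (intro mult_mono powr_mono2') auto
    thus ?thesis using z t a by simp
  qed auto
  show "0 \<le> (N + q) powr a - N powr a" "(N + q) powr a - N powr a \<le> N powr (a - 1)"
    using 1[OF q] by auto
  have "0 \<le> (N + q) powr (a + 1) / (a + 1) - N powr (a + 1) / (a + 1) - N powr a * q \<and>
     (N + q) powr (a + 1) / (a + 1) - N powr (a + 1) / (a + 1) - N powr a * q \<le> N powr (a - 1)"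
  proof (cases "q = 0")
    case False
    have "\<exists>z>0. z < q \<and> ((N + q) powr (a + 1) / (a + 1) - N powr a * q) - ((N + 0) powr (a + 1) / (a + 1) - N powr a * 0)
            = (q - 0) * ((N + z) powr a - N powr a)"
      using q False N a by (intro MVT2) (auto intro!: derivative_eq_intros)
    then obtain z where z: "z > 0" "z < q"
      "((N + q) powr (a + 1) / (a + 1) - N powr (a + 1) / (a + 1) - N powr a * q) = q * ((N + z) powr a - N powr a)"
      by auto
    have "q * ((N + z) powr a - N powr a) \<le> 1 * N powr (a - 1)"
      using q z 1[of z] by (intro mult_mono) auto
    thus ?thesis using z 1[of z] q by simp
  qed auto
  thus "0 \<le> (N + q) powr (a + 1) / (a + 1) - N powr (a + 1) / (a + 1) - N powr a * q"
    "(N + q) powr (a + 1) / (a + 1) - N powr (a + 1) / (a + 1) - N powr a * q \<le> N powr (a - 1)"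
    by auto
qed

text \<open>The value at 0 is borrowed from q = 1, because \<open>hz_right\<close> is understood
  only on (0,1]. Real values are taken to fit the real form of Fourier uniqueness.\<close>

definition hz_per :: "real \<Rightarrow> real \<Rightarrow> real" where
  "hz_per a q = Re (hz_right (- of_real a) (if q = 0 then 1 else q))"

lemma uniform_limit_hz_poly:
  assumes a: "0 < a" "a < 1"
  shows "uniform_limit {0..1} (hz_poly a) (hz_per a) sequentially"
proof -
  \<comment> \<open>The approximants of \<open>hz_right_partial\<close> at s = -a, in real powers;
    \<open>hz_poly\<close> differs from them by the two Taylor remainders, hence by
    O(N^(a-1)).\<close>
  define V where "V = (\<lambda>N q. (\<Sum>n<N. (real n + q) powr a) + (real N + q) powr a / 2 - (real N + q) powr (a + 1) / (a + 1))"
  have "uniform_limit {0<..1}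
     (\<lambda>N q. (\<Sum>n<N. of_real (real n + q) powr (-(- of_real a))) + of_real (real N + q) powr (-(- of_real a)) / 2
             + of_real (real N + q) powr (1 - (- of_real a)) / (- of_real a - 1))
     (\<lambda>q. hz_right (- of_real a) q) sequentially"
    by (rule uniform_limit_compose'[OF hz_right_partial[of "-a" a], where h = "\<lambda>q. (- of_real a, q)", unfolded prod.case])
       (use a in \<open>auto simp: complex_eq_iff\<close>)
  from bounded_linear.uniform_limit[OF bounded_linear_Re this]
  have "uniform_limit {0<..1} V (\<lambda>q. Re (hz_right (- of_real a) q)) sequentially"
  proof (rule uniform_limit_cong'[THEN iffD1, rotated -1])
    fix N :: nat and q :: real assume q: "q \<in> {0<..1}"
    have p: "complex_of_real (real n + q) powr of_real b = of_real ((real n + q) powr b)" for n b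
      using q by (subst powr_of_real) auto
    have e: "1 - (- complex_of_real a) = of_real (a + 1)" "- complex_of_real a - 1 = of_real (- (a + 1))" by simp_all
    have "(\<Sum>n<N. of_real (real n + q) powr (-(- of_real a))) + of_real (real N + q) powr (-(- of_real a)) / 2
             + of_real (real N + q) powr (1 - (- of_real a)) / (- of_real a - 1) = complex_of_real (V N q)"
      unfolding e minus_minus p V_def 
      by (simp del: minus_add_distrib)
    thus "Re ((\<Sum>n<N. of_real (real n + q) powr (-(- of_real a))) + of_real (real N + q) powr (-(- of_real a)) / 2
             + of_real (real N + q) powr (1 - (- of_real a)) / (- of_real a - 1)) = V N q"
      by (simp only: Re_complex_of_real)
  qed auto
  moreover have "uniform_limit {0<..1} (\<lambda>N q. hz_poly a N q - V N q) (\<lambda>q. 0) sequentially"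
  proof (rule uniform_limitI)
    fix e :: real assume e: "e > 0"
    have "(\<lambda>N. 2 * real N powr (a - 1)) \<longlonglongrightarrow> 0" using a by real_asymp
    hence "\<forall>\<^sub>F N in sequentially. 2 * real N powr (a - 1) < e"
      using e by (rule order_tendstoD)
    thus "\<forall>\<^sub>F N in sequentially. \<forall>q\<in>{0<..1}. dist (hz_poly a N q - V N q) 0 < e"
      using eventually_gt_at_top[of 0]
    proof eventually_elim
      case (elim N)
      show ?case
      proof
        fix q :: real assume q: "q \<in> {0<..1}"
        have "hz_poly a N q - V N q = ((real N + q) powr (a + 1) / (a + 1) - real N powr (a + 1) / (a + 1) - real N powr a * q)
                 - ((real N + q) powr a - real N powr a) / 2"
          by (simp add: hz_poly_def V_def field_simps)
        moreover have "\<bar>x - y / 2\<bar> \<le> 2 * b" if "0 \<le> x" "x \<le> b" "0 \<le> y" "y \<le> b" for x y b :: real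
          using that by linarith
        ultimately have "\<bar>hz_poly a N q - V N q\<bar> \<le> 2 * real N powr (a - 1)"
          using powr_taylor_bounds[OF a, of "real N" q] elim q by auto
        thus "dist (hz_poly a N q - V N q) 0 < e" using elim by (simp add: dist_norm)
      qed
    qed
  qed
  ultimately have "uniform_limit {0<..1} (\<lambda>N q. V N q + (hz_poly a N q - V N q))
      (\<lambda>q. Re (hz_right (- of_real a) q) + 0) sequentially"
    by (rule uniform_limit_add)
  hence "uniform_limit {0<..1} (hz_poly a) (\<lambda>q. Re (hz_right (- of_real a) q)) sequentially"
    by simp
  \<comment> \<open>Exact periodicity of the approximants carries uniform convergence from (0,1] to
    the closed interval.\<close>
  hence "uniform_limit {0..1} (\<lambda>N q. hz_poly a N (if q = 0 then 1 else q)) (hz_per a) sequentially"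
    unfolding hz_per_def by (rule uniform_limit_compose') auto
  also have "(\<lambda>N q. hz_poly a N (if q = 0 then 1 else q)) = hz_poly a"
    using hz_poly_periodic[OF a(1)] by (auto simp: fun_eq_iff)
  finally show ?thesis .
qed

lemma continuous_on_hz_per: "0 < a \<Longrightarrow> a < 1 \<Longrightarrow> continuous_on {0..1} (hz_per a)"
  by (rule uniform_limit_theorem[OF _ uniform_limit_hz_poly]) (auto intro!: always_eventually continuous_intros)

lemma hz_right_eq_hz_per:
  assumes a: "0 < a" "a < 1" and q: "q \<in> {0<..1}"
  shows "hz_right (- of_real a) q = of_real (hz_per a q)"
proof -
  have "hz_right (- of_real a) q \<in> \<real>"
  proof (rule Lim_in_closed_set[OF closed_complex_Reals _ _ hz_right_partial_tendsto])
    have e: "1 - (- complex_of_real a) = of_real (a + 1)" by simp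
    have p: "complex_of_real (real n + q) powr of_real b = of_real ((real n + q) powr b)" for n b
      using q by (subst powr_of_real) auto
    show "\<forall>\<^sub>F N in sequentially. (\<Sum>n<N. of_real (real n + q) powr (-(- complex_of_real a))) + of_real (real N + q) powr (-(- complex_of_real a)) / 2
             + of_real (real N + q) powr (1 - (- of_real a)) / (- of_real a - 1) \<in> \<real>"
      unfolding e minus_minus p by (intro always_eventually allI Reals_add Reals_divide sum_in_Reals Reals_diff) auto
  qed (use a q in \<open>auto simp: complex_eq_iff\<close>)
  thus ?thesis using q by (simp add: hz_per_def)
qed

text \<open>Because \<open>fexp k\<close> has period 1, translating the n-th summand by n tiles
  [0,N].\<close>

lemma integral_powr_fexp_shift:
  assumes a: "a > 0"
  shows "((\<lambda>q. of_real (\<Sum>n<N. (real n + q) powr a) * fexp k q) has_integral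
            integral {0..real N} (\<lambda>x. of_real (x powr a) * fexp k x)) {0..1}"
proof (induction N)
  case (Suc N)
  let ?F = "\<lambda>x. of_real (x powr a) * fexp k x"
  have int: "?F integrable_on {u..v}" if "u \<ge> 0" for u v
    using a that by (intro integrable_continuous_real continuous_intros continuous_on_powr') auto
  have per: "fexp k (x + real N) = fexp k x" for x
  proof -
    have "fexp k (x + real N) = fexp k x * cis (2 * pi * of_int (k * int N))"
      by (simp add: fexp_def cis_mult algebra_simps)
    also have "cis (2 * pi * of_int (k * int N)) = 1" by (rule cis_multiple_2pi) auto
    finally show ?thesis by simp
  qed
  have "(?F has_integral integral {real N..real N + 1} ?F) {real N..real N + 1}"
    using int by (intro integrable_integral) auto
  from has_integral_shift_real_ivl[OF this, of "real N"]
  have "((\<lambda>q. of_real ((real N + q) powr a) * fexp k q) has_integral integral {real N..real N + 1} ?F) {0..1}"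
    by (simp add: per add_ac)
  from has_integral_add[OF Suc this]
  have "((\<lambda>q. of_real (\<Sum>n<Suc N. (real n + q) powr a) * fexp k q) has_integral
          (integral {0..real N} ?F + integral {real N..real N + 1} ?F)) {0..1}"
    by (simp add: ring_distribs)
  also have "integral {0..real N} ?F + integral {real N..real N + 1} ?F = integral {0..real N + 1} ?F"
    by (rule Henstock_Kurzweil_Integration.integral_combine) (auto intro: int)
  finally show ?case by (simp add: add_ac)
qed auto

lemma hz_poly_fourier_tendsto:
  assumes a: "0 < a" "a < 1" and k: "k \<noteq> 0"
  shows "(\<lambda>N. integral {0..1} (\<lambda>q. of_real (hz_poly a N q) * fexp (-k) q)) \<longlonglongrightarrow>
            of_real (Gamma (a + 1)) * (\<i> * of_real (2 * pi * of_int k)) powr (- of_real (a + 1))"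
proof -
  define c where "c = \<i> * complex_of_real (2 * pi * of_int k)"
  have c: "c \<noteq> 0" using k by (simp add: c_def)
  have fe: "fexp (-k) x = exp (- c * of_real x)" for x
    by (simp add: fexp_eq_exp c_def)
  have der: "((\<lambda>x. exp (- c * of_real x) / (-c)) has_vector_derivative exp (- c * of_real x)) (at x within A)" for x A
  proof -
    have "((\<lambda>z. exp (- c * z) / (-c)) has_field_derivative exp (- c * of_real x)) (at (of_real x))"
      using c by (auto intro!: derivative_eq_intros)
    thus ?thesis by (rule has_vector_derivative_real_field)
  qed
  define L where "L = (\<lambda>N. integral {0..N} (\<lambda>x. of_real (x powr (a - 1)) * exp (- c * of_real x)))"
  have L: "(L \<longlongrightarrow> of_real (Gamma a) * c powr (- of_real a)) at_top"
    unfolding L_def c_def using k by (intro fourier_powr_tendsto a) auto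
  \<comment> \<open>Integration by parts lowers the exponent to a - 1; the upper boundary term is
    simply -N^a / c because exp(-cN) = 1 at the integer N.\<close>
  have J: "integral {0..real N} (\<lambda>x. of_real (x powr a) * fexp (-k) x) = - of_real (real N powr a) / c + of_real a / c * L (real N)" for N
  proof -
    let ?f = "\<lambda>x. of_real (x powr a) * (exp (- c * of_real x) / (-c))"
    have "((\<lambda>x. of_real (x powr a) * exp (- c * of_real x) + of_real (a * x powr (a - 1)) * (exp (- c * of_real x) / (-c)))
             has_integral ?f (real N) - ?f 0) {0..real N}"
    proof (rule fundamental_theorem_of_calculus_interior)
      show "continuous_on {0..real N} ?f"
        using a c by (intro continuous_intros continuous_on_powr') auto
      fix x assume x: "x \<in> {0<..<real N}"
      have "((\<lambda>x. of_real (x powr a) :: complex) has_vector_derivative of_real (a * x powr (a - 1))) (at x)"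
        using x by (intro has_vector_derivative_of_real) (auto intro!: derivative_eq_intros)
      from has_vector_derivative_mult[OF this der]
      show "(?f has_vector_derivative of_real (x powr a) * exp (- c * of_real x) + of_real (a * x powr (a - 1)) * (exp (- c * of_real x) / (-c))) (at x)" .
    qed auto
    moreover have "((\<lambda>x. of_real a / c * (of_real (x powr (a - 1)) * exp (- c * of_real x))) has_integral of_real a / c * L (real N)) {0..real N}"
      unfolding L_def using has_integral_powr_exp[OF a(1), of "real N" c]
      by (intro has_integral_mult_right integrable_integral) auto
    ultimately have "((\<lambda>x. of_real (x powr a) * exp (- c * of_real x) + of_real (a * x powr (a - 1)) * (exp (- c * of_real x) / (-c))
            + of_real a / c * (of_real (x powr (a - 1)) * exp (- c * of_real x)))
           has_integral ?f (real N) - ?f 0 + of_real a / c * L (real N)) {0..real N}"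
      by (rule has_integral_add)
    also have "(\<lambda>x. of_real (x powr a) * exp (- c * of_real x) + of_real (a * x powr (a - 1)) * (exp (- c * of_real x) / (-c))
            + of_real a / c * (of_real (x powr (a - 1)) * exp (- c * of_real x))) = (\<lambda>x. of_real (x powr a) * fexp (-k) x)"
      by (simp add: fe fun_eq_iff)
    also have "exp (- c * of_real (real N)) = 1"
      using fe[of "real N"] cis_multiple_2pi[of "- of_int k * real N"] by (simp add: fexp_def mult_ac)
    finally show ?thesis using a by (simp add: integral_unique)
  qed
  have Q: "((\<lambda>q. of_real (q - 1 / 2) * fexp (-k) q) has_integral - (1 / c)) {0..1}"
  proof -
    let ?f = "\<lambda>x. of_real (x - 1 / 2) * (exp (- c * of_real x) / (-c))"
    have "((\<lambda>x. of_real (x - 1 / 2) * exp (- c * of_real x) + 1 * (exp (- c * of_real x) / (-c)))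
             has_integral ?f 1 - ?f 0) {0..1}"
    proof (rule fundamental_theorem_of_calculus)
      fix x :: real
      have "((\<lambda>x. of_real (x - 1 / 2) :: complex) has_vector_derivative of_real 1) (at x within {0..1})"
        by (intro has_vector_derivative_of_real) (auto intro!: derivative_eq_intros)
      from has_vector_derivative_mult[OF this der]
      show "(?f has_vector_derivative of_real (x - 1 / 2) * exp (- c * of_real x) + 1 * (exp (- c * of_real x) / (-c))) (at x within {0..1})"
        by simp
    qed auto
    moreover have "((\<lambda>x. (1 / c) * fexp (-k) x) has_integral (1 / c) * 0) {0..1}"
      using has_integral_fexp[of "-k"] k by (intro has_integral_mult_right) simp
    ultimately have "((\<lambda>x. of_real (x - 1 / 2) * exp (- c * of_real x) + 1 * (exp (- c * of_real x) / (-c)) + (1 / c) * fexp (-k) x)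
        has_integral ?f 1 - ?f 0 + (1 / c) * 0) {0..1}"
      by (rule has_integral_add)
    also have "(\<lambda>x. of_real (x - 1 / 2) * exp (- c * of_real x) + 1 * (exp (- c * of_real x) / (-c)) + (1 / c) * fexp (-k) x)
        = (\<lambda>q. of_real (q - 1 / 2) * fexp (-k) q)"
      by (simp add: fe fun_eq_iff)
    also have "exp (- c * of_real 1) = 1" using fe[of 1] by simp
    finally show ?thesis using c by (simp add: field_simps)
  qed
  \<comment> \<open>The divergent -N^a / c from \<open>J\<close> cancels against -N^a times the
    coefficient -1/c from \<open>Q\<close>; the constant term is invisible since k \<noteq>
    0.\<close>
  have I: "integral {0..1} (\<lambda>q. of_real (hz_poly a N q) * fexp (-k) q) = of_real a / c * L (real N)" for N
  proof -
    have "((\<lambda>q. of_real (\<Sum>n<N. (real n + q) powr a) * fexp (-k) q - of_real (real N powr (a + 1) / (a + 1)) * fexp (-k) q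
            - of_real (real N powr a) * (of_real (q - 1 / 2) * fexp (-k) q))
          has_integral (integral {0..real N} (\<lambda>x. of_real (x powr a) * fexp (-k) x)
            - of_real (real N powr (a + 1) / (a + 1)) * 0 - of_real (real N powr a) * - (1 / c))) {0..1}"
      using has_integral_fexp[of "-k"] k
      by (intro has_integral_diff has_integral_mult_right Q integral_powr_fexp_shift a) auto
    also have "(\<lambda>q. of_real (\<Sum>n<N. (real n + q) powr a) * fexp (-k) q - of_real (real N powr (a + 1) / (a + 1)) * fexp (-k) q
            - of_real (real N powr a) * (of_real (q - 1 / 2) * fexp (-k) q)) = (\<lambda>q. of_real (hz_poly a N q) * fexp (-k) q)"
      unfolding hz_poly_def of_real_diff of_real_mult by (simp add: left_diff_distrib mult.assoc)
    finally show ?thesis unfolding J by (simp add: integral_unique)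
  qed
  have "(\<lambda>N. of_real a / c * L (real N)) \<longlonglongrightarrow> of_real a / c * (of_real (Gamma a) * c powr (- of_real a))"
    by (intro tendsto_intros filterlim_compose[OF L] filterlim_real_sequentially)
  also have "of_real a / c * (of_real (Gamma a) * c powr (- of_real a)) = of_real (Gamma (a + 1)) * c powr (- of_real (a + 1))"
  proof -
    have "c powr (- of_real (a + 1)) = c powr (- of_real a - 1)" by simp
    also have "\<dots> = c powr (- of_real a) / c" using c by (simp add: powr_diff)
    moreover have "Gamma (a + 1) = a * Gamma a"
      by (rule Gamma_plus1) (use a in \<open>auto elim!: nonpos_Ints_cases\<close>)
    ultimately show ?thesis by simp
  qed
  finally show ?thesis unfolding I c_def .
qed

lemma hz_per_fourier_coeff:
  assumes a: "0 < a" "a < 1" and k: "k \<noteq> 0"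
  shows "((\<lambda>q. of_real (hz_per a q) * fexp (-k) q) has_integral
            of_real (Gamma (a + 1)) * (\<i> * of_real (2 * pi * of_int k)) powr (- of_real (a + 1))) {0..1}"
proof -
  have "uniform_limit {0..1} (\<lambda>N q. of_real (hz_poly a N q) * fexp (-k) q) (\<lambda>q. of_real (hz_per a q) * fexp (-k) q) sequentially"
  proof (rule uniform_limitI)
    fix e :: real assume "e > 0"
    with uniform_limit_hz_poly[OF a] have "\<forall>\<^sub>F N in sequentially. \<forall>q\<in>{0..1}. dist (hz_poly a N q) (hz_per a q) < e"
      by (simp add: uniform_limit_iff)
    moreover have "dist (of_real x * fexp (-k) q) (of_real y * fexp (-k) q) = dist x y" for x y q
      by (simp add: dist_norm norm_mult flip: left_diff_distrib of_real_diff)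
    ultimately show "\<forall>\<^sub>F N in sequentially. \<forall>q\<in>{0..1}. dist (of_real (hz_poly a N q) * fexp (-k) q) (of_real (hz_per a q) * fexp (-k) q) < e"
      by simp
  qed
  moreover have "continuous_on {0..1} (\<lambda>q. of_real (hz_poly a N q) * fexp (-k) q)" for N
    by (intro continuous_intros a)
  ultimately obtain I J where IJ:
    "\<And>N. ((\<lambda>q. of_real (hz_poly a N q) * fexp (-k) q) has_integral I N) {0..1}"
    "((\<lambda>q. of_real (hz_per a q) * fexp (-k) q) has_integral J) {0..1}" "I \<longlonglongrightarrow> J"
    using uniform_limit_integral[OF _ _ trivial_limit_sequentially] by blast
  have "J = of_real (Gamma (a + 1)) * (\<i> * of_real (2 * pi * of_int k)) powr (- of_real (a + 1))"
    using LIMSEQ_unique[OF IJ(3)] hz_poly_fourier_tendsto[OF a k] integral_unique[OF IJ(1)] by simp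
  with IJ(2) show "((\<lambda>q. of_real (hz_per a q) * fexp (-k) q) has_integral
            of_real (Gamma (a + 1)) * (\<i> * of_real (2 * pi * of_int k)) powr (- of_real (a + 1))) {0..1}" by simp
qed

text \<open>Frequency 0: the constant N^(a+1) / (a+1) in \<open>hz_poly\<close> is the integral of
  x^a over [0,N], and q - 1/2 has mean 0, so every approximant already has mean 0.\<close>

lemma hz_per_has_integral_0:
  assumes a: "0 < a" "a < 1"
  shows "(hz_per a has_integral 0) {0..1}"
proof -
  obtain I J where IJ: "\<And>N. (hz_poly a N has_integral I N) {0..1}" "(hz_per a has_integral J) {0..1}" "I \<longlonglongrightarrow> J"
    using uniform_limit_integral[OF uniform_limit_hz_poly[OF a]] a by (auto intro!: continuous_intros)
  have "(hz_poly a N has_integral 0) {0..1}" for N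
  proof -
    have "((\<lambda>x. x powr a) has_integral real N powr (a + 1) / (a + 1)) {0..real N}"
      using has_integral_powr_from_0[of a "real N"] a by simp
    from has_integral_of_real[OF this, where 'b = complex]
    have 1: "integral {0..real N} (\<lambda>x. of_real (x powr a) * fexp 0 x) = complex_of_real (real N powr (a + 1) / (a + 1))"
      by (simp add: integral_unique)
    have "((\<lambda>q. complex_of_real (\<Sum>n<N. (real n + q) powr a)) has_integral of_real (real N powr (a + 1) / (a + 1))) {0..1}"
      using integral_powr_fexp_shift[OF a(1), of N 0] unfolding 1 by simp
    from has_integral_linear[OF this bounded_linear_Re]
    have 2: "((\<lambda>q. (\<Sum>n<N. (real n + q) powr a)) has_integral real N powr (a + 1) / (a + 1)) {0..1}"
      by (simp only: o_def Re_complex_of_real)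
    have 3: "((\<lambda>q::real. q - 1 / 2) has_integral 0) {0..1}"
    proof -
      have "((\<lambda>q::real. q - 1 / 2) has_integral (1 ^ 2 / 2 - 1 / 2) - (0 ^ 2 / 2 - 0 / 2)) {0..1}"
        by (rule fundamental_theorem_of_calculus)
           (auto intro!: derivative_eq_intros simp flip: has_real_derivative_iff_has_vector_derivative)
      thus ?thesis by simp
    qed
    have 4: "((\<lambda>q::real. real N powr (a + 1) / (a + 1)) has_integral real N powr (a + 1) / (a + 1)) {0..1}"
      using has_integral_const_real[of "real N powr (a + 1) / (a + 1)" 0 1] by simp
    show ?thesis
      using has_integral_diff[OF has_integral_diff[OF 2 4] has_integral_mult_right[OF 3, of "real N powr a"]]
      unfolding hz_poly_def by simp
  qed
  hence "I = (\<lambda>_. 0)" using IJ(1) has_integral_unique by blast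
  hence "J = 0" using IJ(3) LIMSEQ_unique by (metis tendsto_const)
  thus "(hz_per a has_integral 0) {0..1}" using IJ(2) by simp
qed

section \<open>Hurwitz's formula\<close>

text \<open>A Dirichlet series in 1 - s; \<open>c n\<close> belongs to frequency n + 1.\<close>

definition dser :: "(nat \<Rightarrow> real) \<Rightarrow> complex \<Rightarrow> complex" where
  "dser c s = (\<Sum>n. of_real (real (Suc n)) powr (s - 1) * of_real (c n))"

lemma norm_dser_term_le:
  assumes "\<bar>c n\<bar> \<le> 1" "Re s \<le> \<sigma>"
  shows "norm (of_real (real (Suc n)) powr (s - 1) * of_real (c n)) \<le> real (Suc n) powr (\<sigma> - 1)"
proof -
  have "norm (of_real (real (Suc n)) powr (s - 1)) = real (Suc n) powr (Re s - 1)"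
    by (subst norm_powr_real_powr) auto
  also have "\<dots> \<le> real (Suc n) powr (\<sigma> - 1)"
    using assms by (intro powr_mono) auto
  finally have "norm (of_real (real (Suc n)) powr (s - 1)) * \<bar>c n\<bar> \<le> real (Suc n) powr (\<sigma> - 1) * 1"
    using assms by (intro mult_mono) auto
  thus ?thesis by (simp only: norm_mult norm_of_real mult_1_right)
qed

lemma summable_Suc_powr: "\<sigma> < 0 \<Longrightarrow> summable (\<lambda>n. real (Suc n) powr (\<sigma> - 1))"
  using summable_Suc_iff[of "\<lambda>n. real n powr (\<sigma> - 1)"] by (simp add: summable_real_powr_iff)

lemma holomorphic_dser:
  assumes "\<And>n. \<bar>c n\<bar> \<le> 1"
  shows "dser c holomorphic_on {s. Re s < 0}"
proof (rule holomorphic_uniform_sequence)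
  show "open {s. Re s < 0}" by (rule open_halfspace_Re_lt)
  show "(\<lambda>s. \<Sum>n<N. of_real (real (Suc n)) powr (s - 1) * of_real (c n)) holomorphic_on {s. Re s < 0}" for N
    by (intro holomorphic_intros) (auto simp del: of_nat_Suc)
  fix x :: complex assume x: "x \<in> {s. Re s < 0}"
  define d where "d = - Re x / 2"
  have d: "d > 0" "Re x + d < 0" using x by (auto simp: d_def)
  have Re: "Re s \<le> Re x + d" if "s \<in> cball x d" for s
    using that abs_Re_le_cmod[of "s - x"] by (simp add: dist_norm norm_minus_commute)
  have "uniform_limit (cball x d) (\<lambda>N s. \<Sum>n<N. of_real (real (Suc n)) powr (s - 1) * of_real (c n)) (dser c) sequentially"
    unfolding dser_def [abs_def]
    by (rule Weierstrass_m_test[OF norm_dser_term_le[OF assms Re] summable_Suc_powr[OF d(2)]])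
  moreover have "cball x d \<subseteq> {s. Re s < 0}" using Re d by fastforce
  ultimately show "\<exists>d>0. cball x d \<subseteq> {s. Re s < 0} \<and> uniform_limit (cball x d)
      (\<lambda>N s. \<Sum>n<N. of_real (real (Suc n)) powr (s - 1) * of_real (c n)) (dser c) sequentially"
    using d by blast
qed

lemma summable_Suc_powr_mult:
  assumes "z < 0" "\<And>n. \<bar>c n\<bar> \<le> 1"
  shows "summable (\<lambda>n. real (Suc n) powr (z - 1) * c n)"
proof (rule summable_comparison_test'[OF summable_Suc_powr[OF assms(1)], of 0])
  show "norm (real (Suc n) powr (z - 1) * c n) \<le> real (Suc n) powr (z - 1)" for n
    using mult_left_mono[OF assms(2)[of n], of "real (Suc n) powr (z - 1)"] by (simp add: abs_mult)
qed

lemma dser_of_real: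
  assumes "z < 0" "\<And>n. \<bar>c n\<bar> \<le> 1"
  shows "dser c (of_real z) = of_real (\<Sum>n. real (Suc n) powr (z - 1) * c n)"
proof -
  have "of_real (real (Suc n)) powr (of_real z - 1) = complex_of_real (real (Suc n) powr (z - 1))" for n
    by (subst powr_of_real [symmetric]) auto
  thus ?thesis
    unfolding dser_def suminf_of_real[OF summable_Suc_powr_mult[OF assms]] by simp
qed

text \<open>The phase \<beta> merges the sine and the cosine series of Hurwitz's formula into one;
  the value needed there is pi z / 2.\<close>

definition fser :: "real \<Rightarrow> real \<Rightarrow> real \<Rightarrow> real" where
  "fser z \<beta> q = (\<Sum>n. real (Suc n) powr (z - 1) * sin (2 * pi * real (Suc n) * q + \<beta>))"

lemma uniform_limit_fser:
  assumes "z < 0"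
  shows "uniform_limit A (\<lambda>N q. \<Sum>n<N. real (Suc n) powr (z - 1) * sin (2 * pi * real (Suc n) * q + \<beta>)) (fser z \<beta>) sequentially"
  unfolding fser_def [abs_def]
proof (rule Weierstrass_m_test[OF _ summable_Suc_powr[OF assms]])
  show "norm (real (Suc n) powr (z - 1) * sin (2 * pi * real (Suc n) * q + \<beta>)) \<le> real (Suc n) powr (z - 1)" for n q
    using mult_left_mono[OF abs_sin_le_one[of "2 * pi * real (Suc n) * q + \<beta>"], of "real (Suc n) powr (z - 1)"]
    by (simp add: abs_mult)
qed

lemma continuous_on_fser [continuous_intros]: "z < 0 \<Longrightarrow> continuous_on A (fser z \<beta>)"
  by (rule uniform_limit_theorem[OF _ uniform_limit_fser]) (auto intro!: always_eventually continuous_intros)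

text \<open>Uniform convergence permits termwise integration. It serves twice: with a sine for
  \<open>f\<close> it gives the Fourier coefficients of \<open>fser\<close>, with the other zeta
  factor it gives the product integrals.\<close>

lemma fser_pairing:
  assumes z: "z < 0" and f: "continuous_on {0..1} f"
    and b: "\<And>n. ((\<lambda>q. f q * sin (2 * pi * real (Suc n) * q + \<beta>)) has_integral b n) {0..1}"
  shows "\<exists>J. ((\<lambda>q. f q * fser z \<beta> q) has_integral J) {0..1} \<and> (\<lambda>n. real (Suc n) powr (z - 1) * b n) sums J"
proof -
  let ?P = "\<lambda>N q. \<Sum>n<N. real (Suc n) powr (z - 1) * sin (2 * pi * real (Suc n) * q + \<beta>)"
  have "uniform_limit {0..1} (\<lambda>N q. f q * ?P N q) (\<lambda>q. f q * fser z \<beta> q) sequentially"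
    by (intro uniform_lim_mult uniform_limit_const uniform_limit_fser z compact_imp_bounded
          compact_continuous_image f continuous_on_fser) auto
  moreover have "continuous_on {0..1} (\<lambda>q. f q * ?P N q)" for N
    by (intro continuous_intros f)
  ultimately obtain I J where IJ: "\<And>N. ((\<lambda>q. f q * ?P N q) has_integral I N) {0..1}"
    "((\<lambda>q. f q * fser z \<beta> q) has_integral J) {0..1}" "I \<longlonglongrightarrow> J"
    using uniform_limit_integral[OF _ _ trivial_limit_sequentially] by blast
  have "((\<lambda>q. f q * ?P N q) has_integral (\<Sum>n<N. real (Suc n) powr (z - 1) * b n)) {0..1}" for N
  proof -
    have "((\<lambda>q. \<Sum>n<N. real (Suc n) powr (z - 1) * (f q * sin (2 * pi * real (Suc n) * q + \<beta>)))
             has_integral (\<Sum>n<N. real (Suc n) powr (z - 1) * b n)) {0..1}"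
      by (intro has_integral_sum has_integral_mult_right b) auto
    thus ?thesis by (simp add: sum_distrib_left mult_ac)
  qed
  with IJ(1) have "I = (\<lambda>N. \<Sum>n<N. real (Suc n) powr (z - 1) * b n)"
    using has_integral_unique by blast
  with IJ show ?thesis by (auto simp: sums_def)
qed

lemma has_integral_cos_period:
  "((\<lambda>q. cos (2 * pi * real_of_int j * q + \<gamma>)) has_integral (if j = 0 then cos \<gamma> else 0)) {0..1}"
proof -
  have "((\<lambda>q. cis \<gamma> * fexp j q) has_integral cis \<gamma> * (if j = 0 then 1 else 0)) {0..1}"
    by (intro has_integral_mult_right has_integral_fexp)
  from has_integral_linear[OF this bounded_linear_Re] show ?thesis
    by (auto simp: o_def fexp_def cis_mult add_ac split: if_splits)
qed

lemma has_integral_sin_sin: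
  assumes "m > 0"
  shows "((\<lambda>q. sin (2 * pi * real m * q + \<alpha>) * sin (2 * pi * real k * q + \<beta>))
            has_integral (if m = k then cos (\<alpha> - \<beta>) / 2 else 0)) {0..1}"
proof -
  have "((\<lambda>q. (cos (2 * pi * real_of_int (int m - int k) * q + (\<alpha> - \<beta>))
                - cos (2 * pi * real_of_int (int m + int k) * q + (\<alpha> + \<beta>))) / 2)
           has_integral ((if int m - int k = 0 then cos (\<alpha> - \<beta>) else 0) - (if int m + int k = 0 then cos (\<alpha> + \<beta>) else 0)) / 2) {0..1}"
    by (intro has_integral_divide has_integral_diff has_integral_cos_period)
  also have "(\<lambda>q. (cos (2 * pi * real_of_int (int m - int k) * q + (\<alpha> - \<beta>))
                - cos (2 * pi * real_of_int (int m + int k) * q + (\<alpha> + \<beta>))) / 2)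
      = (\<lambda>q. sin (2 * pi * real m * q + \<alpha>) * sin (2 * pi * real k * q + \<beta>))"
    by (auto simp: sin_times_sin algebra_simps fun_eq_iff)
  finally show ?thesis using assms by auto
qed

text \<open>A free \<beta> covers sine and cosine coefficients at once; k = 0 with \<beta> = pi / 2
  is the mean value.\<close>

lemma fser_coeff:
  assumes z: "z < 0"
  shows "((\<lambda>q. fser z \<alpha> q * sin (2 * pi * real k * q + \<beta>)) has_integral
            (if k = 0 then 0 else real k powr (z - 1) * cos (\<alpha> - \<beta>) / 2)) {0..1}"
proof -
  let ?f = "\<lambda>q. sin (2 * pi * real k * q + \<beta>)"
  have "((\<lambda>q. ?f q * sin (2 * pi * real (Suc n) * q + \<alpha>)) has_integral (if Suc n = k then cos (\<alpha> - \<beta>) / 2 else 0)) {0..1}" for n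
    using has_integral_sin_sin[OF zero_less_Suc, of n \<alpha> k \<beta>] by (subst mult.commute)
  moreover have "continuous_on {0..1} ?f" by (intro continuous_intros)
  ultimately obtain J where J: "((\<lambda>q. ?f q * fser z \<alpha> q) has_integral J) {0..1}"
    "(\<lambda>n. real (Suc n) powr (z - 1) * (if Suc n = k then cos (\<alpha> - \<beta>) / 2 else 0)) sums J"
    using fser_pairing[OF z, of ?f \<alpha> "\<lambda>n. if Suc n = k then cos (\<alpha> - \<beta>) / 2 else 0"] by blast
  have "(\<lambda>n. real (Suc n) powr (z - 1) * (if Suc n = k then cos (\<alpha> - \<beta>) / 2 else 0)) sums
          (if k = 0 then 0 else real k powr (z - 1) * cos (\<alpha> - \<beta>) / 2)"
  proof (cases k)
    case (Suc m)
    have "(\<lambda>n. real (Suc n) powr (z - 1) * (if Suc n = k then cos (\<alpha> - \<beta>) / 2 else 0))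
            = (\<lambda>n. if n = m then real (Suc n) powr (z - 1) * (cos (\<alpha> - \<beta>) / 2) else 0)"
      by (simp add: Suc fun_eq_iff del: of_nat_Suc)
    thus ?thesis
      using sums_single[of m "\<lambda>n. real (Suc n) powr (z - 1) * (cos (\<alpha> - \<beta>) / 2)"]
      by (simp add: Suc del: of_nat_Suc)
  qed simp
  from sums_unique2[OF J(2) this]
  have "J = (if k = 0 then 0 else real k powr (z - 1) * cos (\<alpha> - \<beta>) / 2)" .
  with J(1) show ?thesis by (subst mult.commute) simp
qed

definition hz_const :: "real \<Rightarrow> real" where
  "hz_const z = 2 * Gamma (1 - z) / (2 * pi) powr (1 - z)"

lemma ii_times_powr:
  assumes "x > 0"
  shows "(\<i> * of_real x) powr of_real w = of_real (x powr w) * cis (pi * w / 2)"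
proof -
  have "(of_real x * \<i>) powr of_real w = of_real x powr of_real w * \<i> powr of_real w"
    using assms by (intro powr_times_real_left) auto
  also have "of_real x powr of_real w = complex_of_real (x powr w)"
    using assms by (subst powr_of_real) auto
  also have "\<i> powr of_real w = cis (pi * w / 2)"
    by (simp add: powr_def cis_conv_exp mult_ac)
  finally show ?thesis by (simp add: mult.commute)
qed

lemma sin_add_period: "sin (2 * pi * real n + x) = sin x"
proof -
  have "cis (2 * pi * real n) = 1" by (rule cis_multiple_2pi) simp
  hence "Im (cis (2 * pi * real n) * cis x) = Im (cis x)" by simp
  thus ?thesis by (simp only: cis_mult cis.sel)
qed

text \<open>For the real difference \<open>f\<close>, the coefficients at frequencies -m determine
  those at m by conjugation, and frequency 0 is settled by the two mean values.\<close>

lemma hz_per_eq_fser: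
  assumes a: "0 < a" "a < 1" and q: "q \<in> {0..1}"
  shows "hz_per a q = hz_const (-a) * fser (-a) (- pi * a / 2) q"
proof -
  define f where "f = (\<lambda>q. hz_per a q - hz_const (-a) * fser (-a) (- pi * a / 2) q)"
  have cf: "continuous_on {0..1} f"
    unfolding f_def using a by (intro continuous_intros continuous_on_hz_per) auto
  have coeff: "((\<lambda>q. of_real (f q) * fexp (- int m) q) has_integral 0) {0..1}" if m: "m > 0" for m :: nat
  proof -
    define x where "x = 2 * pi * real m"
    have x: "x > 0" using m by (simp add: x_def)
    let ?s = "\<lambda>\<beta> q. fser (-a) (- pi * a / 2) q * sin (2 * pi * real m * q + \<beta>)"
    have F': "(?s \<beta> has_integral real m powr (-a - 1) * cos (- pi * a / 2 - \<beta>) / 2) {0..1}" for \<beta>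
      using fser_coeff[of "-a" "- pi * a / 2" m \<beta>] a m by (simp only: neg_less_0_iff_less if_False neq0_conv[symmetric])
    have F: "((\<lambda>q. of_real (?s (pi / 2) q) - \<i> * of_real (?s 0 q)) has_integral
           of_real (real m powr (-a - 1) * cos (- pi * a / 2 - pi / 2) / 2)
             - \<i> * of_real (real m powr (-a - 1) * cos (- pi * a / 2 - 0) / 2)) {0..1}"
      by (intro has_integral_diff has_integral_mult_right has_integral_of_real F')
    have G: "((\<lambda>q. of_real (hz_per a q) * fexp (- int m) q) has_integral
            of_real (Gamma (a + 1)) * (of_real (x powr (- (a + 1))) * cis (pi * (- (a + 1)) / 2))) {0..1}"
      using hz_per_fourier_coeff[OF a, of "int m"] m unfolding ii_times_powr[OF x, symmetric] by (simp add: x_def)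
    \<comment> \<open>The exponential is cos - i sin, with the cosine written as a sine of phase pi
      / 2 so that \<open>fser_coeff\<close> gives both parts.\<close>
    have fx: "fexp (- int m) q = of_real (sin (2 * pi * real m * q + pi / 2)) - \<i> * of_real (sin (2 * pi * real m * q + 0))" for q
      by (simp add: complex_eq_iff fexp_def sin_add)
    have xp: "x powr (- (a + 1)) = real m powr (- a - 1) / (2 * pi) powr (1 + a)"
    proof -
      have "x powr (- (a + 1)) = (2 * pi) powr (- (a + 1)) * real m powr (- (a + 1))"
        unfolding x_def by (rule powr_mult)
      also have "(2 * pi) powr (- (a + 1)) = 1 / (2 * pi) powr (1 + a)"
        by (subst powr_minus_divide) (simp only: add.commute)
      also have "- (a + 1) = - a - 1" by simp
      finally show ?thesis by simp
    qed
    have "((\<lambda>q. of_real (hz_per a q) * fexp (- int m) q - of_real (hz_const (-a)) * (of_real (?s (pi / 2) q) - \<i> * of_real (?s 0 q)))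
       has_integral (of_real (Gamma (a + 1)) * (of_real (x powr (- (a + 1))) * cis (pi * (- (a + 1)) / 2))
          - of_real (hz_const (-a)) * (of_real (real m powr (-a - 1) * cos (- pi * a / 2 - pi / 2) / 2)
             - \<i> * of_real (real m powr (-a - 1) * cos (- pi * a / 2 - 0) / 2)))) {0..1}"
      by (intro has_integral_diff has_integral_mult_right G F)
    also have "(\<lambda>q. of_real (hz_per a q) * fexp (- int m) q - of_real (hz_const (-a)) * (of_real (?s (pi / 2) q) - \<i> * of_real (?s 0 q)))
      = (\<lambda>q. of_real (f q) * fexp (- int m) q)"
      unfolding f_def fx by (simp add: algebra_simps)
    also have "of_real (Gamma (a + 1)) * (of_real (x powr (- (a + 1))) * cis (pi * (- (a + 1)) / 2))
          - of_real (hz_const (-a)) * (of_real (real m powr (-a - 1) * cos (- pi * a / 2 - pi / 2) / 2)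
             - \<i> * of_real (real m powr (-a - 1) * cos (- pi * a / 2 - 0) / 2)) = 0"
    proof -
      have A: "pi * (- (a + 1)) / 2 = - pi * a / 2 - pi / 2" by (simp add: field_simps)
      have S: "sin (- pi * a / 2 - pi / 2) = - cos (- pi * a / 2 - 0)"
        by (simp add: sin_diff)
      \<comment> \<open>This matches the phase of (2 pi i m)^(-(a+1)) with the two coefficients of
        the sine series, and it is where the phase -pi a / 2 comes from.\<close>
      have C: "cis (pi * (- (a + 1)) / 2) = of_real (cos (- pi * a / 2 - pi / 2)) - \<i> * of_real (cos (- pi * a / 2 - 0))"
        unfolding A using S by (simp add: complex_eq_iff)
      show ?thesis
        unfolding C xp hz_const_def by (simp add: field_simps add.commute)
    qed
    finally show ?thesis .
  qed
  have "f q = 0"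
  proof (rule fourier_uniqueness_real[OF cf _ _ q])
    have "hz_per a 0 = hz_per a 1" by (simp add: hz_per_def)
    moreover have "fser z \<beta> 0 = fser z \<beta> 1" for z \<beta>
    proof -
      have "sin (2 * pi * real (Suc n) * 1 + \<beta>) = sin (2 * pi * real (Suc n) * 0 + \<beta>)" for n
        by (simp only: mult_1_right mult_zero_right add_0 sin_add_period)
      thus ?thesis by (simp only: fser_def)
    qed
    ultimately show "f 0 = f 1" by (simp add: f_def)
    fix k :: int
    consider "k = 0" | m where "m > 0" "k = - int m" | m where "m > 0" "k = int m"
      by (metis int_cases2 linorder_neqE_nat not_less_zero of_nat_0 minus_zero neq0_conv)
    thus "((\<lambda>q. of_real (f q) * fexp k q) has_integral 0) {0..1}"
    proof cases
      case 1
      have "((\<lambda>q. fser (-a) (- pi * a / 2) q) has_integral 0) {0..1}"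
        using fser_coeff[of "-a" "- pi * a / 2" 0 "pi / 2"] a by simp
      hence "(f has_integral 0 - hz_const (-a) * 0) {0..1}"
        unfolding f_def by (intro has_integral_diff has_integral_mult_right hz_per_has_integral_0 a) auto
      from has_integral_of_real[OF this, where 'b = complex] show ?thesis using 1 by simp
    next
      case 2
      thus ?thesis using coeff by simp
    next
      case (3 m)
      have "cnj \<circ> (\<lambda>q. of_real (f q) * fexp (- int m) q) = (\<lambda>q. of_real (f q) * fexp k q)"
        using 3 by (simp add: fun_eq_iff fexp_def cis_cnj)
      thus ?thesis using coeff[OF 3(1)] has_integral_cnj[of "\<lambda>q. of_real (f q) * fexp (- int m) q" 0 "{0..1}"] by simp
    qed
  qed
  thus ?thesis by (simp add: f_def)
qed

text \<open>Hurwitz's formula with sin(2 pi n q + pi s / 2) expanded: the coefficients passed to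
  \<open>dser\<close> are then real, bounded by 1 and independent of the complex s.\<close>

definition hz_left :: "complex \<Rightarrow> real \<Rightarrow> complex" where
  "hz_left s q = 2 * Gamma (1 - s) * of_real (2 * pi) powr (s - 1) *
     (cos (of_real pi * s / 2) * dser (\<lambda>n. sin (2 * pi * real (Suc n) * q)) s
       + sin (of_real pi * s / 2) * dser (\<lambda>n. cos (2 * pi * real (Suc n) * q)) s)"

lemma holomorphic_hz_left: "(\<lambda>s. hz_left s q) holomorphic_on {s. Re s < 0}"
  unfolding hz_left_def
proof (intro holomorphic_intros holomorphic_dser)
  show "1 - s \<notin> \<int>\<^sub>\<le>\<^sub>0" if "s \<in> {s. Re s < 0}" for s
    using that by (auto elim!: nonpos_Ints_cases simp: complex_eq_iff)
qed auto

lemma of_real_hz_const: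
  "2 * Gamma (1 - of_real z) * of_real (2 * pi) powr (of_real z - 1) = complex_of_real (hz_const z)"
proof -
  have "Gamma (1 - complex_of_real z) = of_real (Gamma (1 - z))"
    by (simp flip: Gamma_complex_of_real)
  moreover have "of_real (2 * pi) powr (of_real z - 1) = complex_of_real ((2 * pi) powr (z - 1))"
    by (subst powr_of_real [symmetric]) auto
  moreover have "(2 * pi) powr (z - 1) = 1 / (2 * pi) powr (1 - z)"
    by (simp flip: powr_minus_divide)
  ultimately show ?thesis by (simp add: hz_const_def)
qed

lemma hz_left_of_real:
  assumes z: "z < 0"
  shows "hz_left (of_real z) q = of_real (hz_const z * fser z (pi * z / 2) q)"
proof -
  let ?S = "\<lambda>n. real (Suc n) powr (z - 1) * sin (2 * pi * real (Suc n) * q)"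
  let ?C = "\<lambda>n. real (Suc n) powr (z - 1) * cos (2 * pi * real (Suc n) * q)"
  have "summable ?S" "summable ?C"
    using z by (intro summable_Suc_powr_mult; simp)+
  hence "(\<lambda>n. cos (pi * z / 2) * ?S n + sin (pi * z / 2) * ?C n) sums (cos (pi * z / 2) * suminf ?S + sin (pi * z / 2) * suminf ?C)"
    by (intro sums_add sums_mult summable_sums)
  also have "(\<lambda>n. cos (pi * z / 2) * ?S n + sin (pi * z / 2) * ?C n)
      = (\<lambda>n. real (Suc n) powr (z - 1) * sin (2 * pi * real (Suc n) * q + pi * z / 2))"
    unfolding sin_add by (simp only: ring_distribs mult_ac)
  finally have "fser z (pi * z / 2) q = cos (pi * z / 2) * suminf ?S + sin (pi * z / 2) * suminf ?C"
    unfolding fser_def by (simp add: sums_iff)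
  moreover have "cos (of_real pi * of_real z / 2) = complex_of_real (cos (pi * z / 2))"
    "sin (of_real pi * of_real z / 2) = complex_of_real (sin (pi * z / 2))"
    by (simp_all flip: cos_of_real sin_of_real)
  ultimately show ?thesis
    unfolding hz_left_def of_real_hz_const using z by (subst (1 2) dser_of_real) auto
qed

text \<open>The Fourier comparison gives equality only on the real segment (-1,0), which has the
  limit point -1/2 in the connected strip; the identity theorem does the rest.\<close>

lemma hz_left_eq_hz_right:
  assumes q: "q \<in> {0<..1}" and s: "-1 < Re s" "Re s < 0"
  shows "hz_left s q = hz_right s q"
proof -
  let ?S = "{s. -1 < Re s} \<inter> {s. Re s < 0}"
  have "hz_left s q - hz_right s q = 0"
  proof (rule analytic_continuation[where f = "\<lambda>s. hz_left s q - hz_right s q" and S = ?S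
      and U = "complex_of_real ` {-1<..<0}" and \<xi> = "of_real (- (1 / 2))"])
    show "(\<lambda>s. hz_left s q - hz_right s q) holomorphic_on ?S"
      by (intro holomorphic_on_diff holomorphic_on_subset[OF holomorphic_hz_left]
            holomorphic_on_subset[OF holomorphic_hz_right[OF q]]) auto
    show "open ?S" by (intro open_Int open_halfspace_Re_gt open_halfspace_Re_lt)
    show "connected ?S"
      by (intro convex_connected convex_Int convex_halfspace_Re_gt convex_halfspace_Re_lt)
    have "(- (1 / 2)) islimpt {-1<..<0::real}" by (rule open_imp_islimpt) auto
    thus "complex_of_real (- (1 / 2)) islimpt (complex_of_real ` {-1<..<0})"
    proof (rule islimpt_isCont_image)
      show "\<forall>\<^sub>F y in at (- (1 / 2)). complex_of_real y \<noteq> complex_of_real (- (1 / 2))"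
        unfolding of_real_eq_iff by (rule eventually_neq_at_within)
    qed simp
    fix w assume "w \<in> complex_of_real ` {-1<..<0}"
    then obtain z where z: "w = of_real z" "-1 < z" "z < 0" by auto
    have "hz_right (of_real z) q = of_real (hz_per (-z) q)"
      using hz_right_eq_hz_per[of "-z" q] z q by simp
    also have "hz_per (-z) q = hz_const z * fser z (pi * z / 2) q"
      using hz_per_eq_fser[of "-z" q] z q by simp
    also have "of_real \<dots> = hz_left (of_real z) q"
      using z by (simp add: hz_left_of_real)
    finally show "hz_left w q - hz_right w q = 0" using z by simp
  qed (use s in auto)
  thus ?thesis by simp
qed

text \<open>The glued function is a witness for the definite description, and any other witness
  agrees with it on Re z > 1, hence on the connected punctured plane.\<close>

lemma hurwitz_zeta_eq:
  assumes q: "q \<in> {0<..1}" and s: "s \<noteq> 1"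
  shows "hurwitz_zeta s q = (if Re s < 0 then hz_left s q else hz_right s q)"
proof -
  define F where "F = (\<lambda>s. if s \<in> {s. Re s < 0} then hz_left s q else hz_right s q)"
  have "F holomorphic_on ({s. Re s < 0} \<union> ({s. Re s > -1} - {1}))"
    unfolding F_def using hz_left_eq_hz_right[OF q]
    by (intro holomorphic_on_If_Un holomorphic_hz_left holomorphic_hz_right q open_Diff
        open_halfspace_Re_gt open_halfspace_Re_lt) auto
  also have "{s. Re s < 0} \<union> ({s. Re s > -1} - {1}) = -{1}" by auto
  finally have hol: "F holomorphic_on -{1}" .
  have ser: "F w = (\<Sum>n. complex_of_real (real n + q) powr (- w))" if "Re w > 1" for w
    using hz_right_sums[OF that q] that by (simp add: F_def sums_iff)
  have "hurwitz_zeta s q = F s"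
    unfolding hurwitz_zeta_def
  proof (rule the_equality)
    show "\<exists>f. f holomorphic_on - {1} \<and> (\<forall>z. 1 < Re z \<longrightarrow> f z = (\<Sum>n. complex_of_real (real n + q) powr - z)) \<and> F s = f s"
      using hol ser by blast
    fix w assume "\<exists>f. f holomorphic_on - {1} \<and> (\<forall>z. 1 < Re z \<longrightarrow> f z = (\<Sum>n. complex_of_real (real n + q) powr - z)) \<and> w = f s"
    then obtain f where f: "f holomorphic_on - {1}" "\<And>z. 1 < Re z \<Longrightarrow> f z = (\<Sum>n. complex_of_real (real n + q) powr - z)" "w = f s"
      by blast
    have "f s = F s"
    proof (rule analytic_continuation_open[where s = "{z. Re z > 1}" and s' = "-{1}" and f = f and g = F])
      show "connected (- {1::complex})" by (rule connected_punctured_universe) simp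
      have "(2::complex) \<in> {z. Re z > 1}" by simp
      thus "{z. Re z > 1} \<noteq> {}" by blast
    qed (use f hol ser s in \<open>auto simp: open_halfspace_Re_gt\<close>)
    thus "w = F s" using f by simp
  qed
  thus ?thesis by (simp add: F_def)
qed

section \<open>Values at real arguments and the product integrals\<close>

definition hz_real :: "real \<Rightarrow> real \<Rightarrow> real" where
  "hz_real z q = (if z = 0 then 1 / 2 - q else hz_const z * fser z (pi * z / 2) q)"

lemma hurwitz_zeta_of_real:
  assumes "z \<le> 0" "q \<in> {0<..1}"
  shows "hurwitz_zeta (of_real z) q = of_real (hz_real z q)"
proof (cases "z = 0")
  case True
  thus ?thesis using assms by (simp add: hurwitz_zeta_eq hz_right_0 hz_real_def)
next
  case False
  hence "z < 0" "complex_of_real z \<noteq> 1" using assms(1) by (auto simp: complex_eq_iff)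
  thus ?thesis using assms(2) by (simp add: hurwitz_zeta_eq hz_left_of_real hz_real_def)
qed

lemma continuous_on_hz_real [continuous_intros]: "z \<le> 0 \<Longrightarrow> continuous_on A (hz_real z)"
  unfolding hz_real_def by (cases "z = 0") (auto intro!: continuous_intros)

text \<open>At z = 0 direct integration of the linear function gives cos \<beta> / (2 pi k), the
  same formula as for z < 0. Hence the factor that is not expanded in a product may have exponent
  0.\<close>

lemma hz_real_coeff:
  assumes z: "z \<le> 0" and k: "k > 0"
  shows "((\<lambda>q. hz_real z q * sin (2 * pi * real k * q + \<beta>)) has_integral
            hz_const z * (real k powr (z - 1) * cos (pi * z / 2 - \<beta>) / 2)) {0..1}"
proof (cases "z = 0")
  case False
  hence "((\<lambda>q. fser z (pi * z / 2) q * sin (2 * pi * real k * q + \<beta>)) has_integral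
            real k powr (z - 1) * cos (pi * z / 2 - \<beta>) / 2) {0..1}"
    using fser_coeff[of z "pi * z / 2" k \<beta>] z k by simp
  from has_integral_mult_right[OF this, of "hz_const z"] show ?thesis
    using False by (simp add: hz_real_def mult.assoc)
next
  case True
  define \<omega> where "\<omega> = 2 * pi * real k"
  have \<omega>: "\<omega> > 0" using k by (simp add: \<omega>_def)
  let ?F = "\<lambda>q. - ((1 / 2 - q) * cos (\<omega> * q + \<beta>) / \<omega>) - sin (\<omega> * q + \<beta>) / \<omega> ^ 2"
  have "((\<lambda>q. (1 / 2 - q) * sin (\<omega> * q + \<beta>)) has_integral ?F 1 - ?F 0) {0..1}"
  proof (rule fundamental_theorem_of_calculus)
    fix q :: real
    have "(?F has_real_derivative (1 / 2 - q) * sin (\<omega> * q + \<beta>)) (at q within {0..1})"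
      using \<omega> by (auto intro!: derivative_eq_intros simp: field_simps power2_eq_square)
    thus "(?F has_vector_derivative (1 / 2 - q) * sin (\<omega> * q + \<beta>)) (at q within {0..1})"
      by (simp only: has_real_derivative_iff_has_vector_derivative)
  qed simp
  also have "?F 1 - ?F 0 = cos \<beta> / \<omega>"
  proof -
    have "sin (\<omega> * 1 + \<beta>) = sin \<beta>" using sin_add_period[of k \<beta>] by (simp add: \<omega>_def)
    moreover have "cos (\<omega> * 1 + \<beta>) = cos \<beta>"
    proof -
      have "cos (\<omega> * 1 + \<beta>) = sin (2 * pi * real k + (\<beta> + pi / 2))"
        by (simp add: \<omega>_def sin_add cos_add)
      also have "\<dots> = cos \<beta>" unfolding sin_add_period by (simp add: sin_add)
      finally show ?thesis .
    qed
    ultimately show ?thesis using \<omega> by (simp only:) (simp add: field_simps)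
  qed
  also have "cos \<beta> / \<omega> = hz_const z * (real k powr (z - 1) * cos (pi * z / 2 - \<beta>) / 2)"
    using True k by (simp add: hz_const_def \<omega>_def powr_minus field_simps)
  finally show ?thesis using True by (simp add: hz_real_def \<omega>_def)
qed

section \<open>The two product integrals\<close>

definition zeta_real :: "real \<Rightarrow> real" where
  "zeta_real x = (\<Sum>n. real (Suc n) powr (- x))"

text \<open>The powers n^(z-1) and n^(z'-1) combine to n^(-(2-z-z')). The phase stays free: pi z / 2
  serves the first integral, pi - pi z / 2 the reflected one.\<close>

lemma hz_real_pairing:
  assumes "z < 0" "z' \<le> 0"
  shows "((\<lambda>q. hz_real z' q * (hz_const z * fser z \<beta> q)) has_integral
           hz_const z * hz_const z' / 2 * zeta_real (2 - z - z') * cos (pi * z' / 2 - \<beta>)) {0..1}"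
proof -
  let ?b = "\<lambda>n. hz_const z' * (real (Suc n) powr (z' - 1) * cos (pi * z' / 2 - \<beta>) / 2)"
  obtain J where J: "((\<lambda>q. hz_real z' q * fser z \<beta> q) has_integral J) {0..1}"
    "(\<lambda>n. real (Suc n) powr (z - 1) * ?b n) sums J"
    using fser_pairing[OF assms(1) continuous_on_hz_real[OF assms(2)] hz_real_coeff[OF assms(2) zero_less_Suc]]
    by blast
  have "summable (\<lambda>n. real (Suc n) powr ((z + z' - 1) - 1))"
    using assms by (intro summable_Suc_powr) auto
  hence "(\<lambda>n. real (Suc n) powr (- (2 - z - z'))) sums zeta_real (2 - z - z')"
    unfolding zeta_real_def by (intro summable_sums) (simp add: algebra_simps del: of_nat_Suc)
  hence "(\<lambda>n. hz_const z' * cos (pi * z' / 2 - \<beta>) / 2 * real (Suc n) powr (- (2 - z - z')))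
           sums (hz_const z' * cos (pi * z' / 2 - \<beta>) / 2 * zeta_real (2 - z - z'))"
    by (rule sums_mult)
  also have "(\<lambda>n. hz_const z' * cos (pi * z' / 2 - \<beta>) / 2 * real (Suc n) powr (- (2 - z - z')))
      = (\<lambda>n. real (Suc n) powr (z - 1) * ?b n)"
  proof
    fix n
    have "real (Suc n) powr (- (2 - z - z')) = real (Suc n) powr (z - 1) * real (Suc n) powr (z' - 1)"
      by (simp add: algebra_simps flip: powr_add)
    thus "hz_const z' * cos (pi * z' / 2 - \<beta>) / 2 * real (Suc n) powr (- (2 - z - z'))
           = real (Suc n) powr (z - 1) * ?b n" by (simp only: mult_ac times_divide_eq_left times_divide_eq_right)
  qed
  finally have "J = hz_const z' * cos (pi * z' / 2 - \<beta>) / 2 * zeta_real (2 - z - z')"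
    using J(2) sums_unique2 by blast
  with has_integral_mult_right[OF J(1), of "hz_const z"] show ?thesis
    by (simp add: mult_ac)
qed

lemma fser_reflect: "fser z \<beta> (1 - q) = fser z (pi - \<beta>) q"
proof -
  have "sin (2 * pi * real (Suc n) * (1 - q) + \<beta>) = sin (2 * pi * real (Suc n) * q + (pi - \<beta>))" for n
  proof -
    have "sin (2 * pi * real (Suc n) * (1 - q) + \<beta>) = sin (2 * pi * real (Suc n) + (\<beta> - 2 * pi * real (Suc n) * q))"
      by (simp only: right_diff_distrib mult_1_right) (simp only: algebra_simps)
    also have "\<dots> = sin (pi - (\<beta> - 2 * pi * real (Suc n) * q))"
      unfolding sin_add_period by (rule sin_pi_minus [symmetric])
    also have "pi - (\<beta> - 2 * pi * real (Suc n) * q) = 2 * pi * real (Suc n) * q + (pi - \<beta>)" by (simp only: algebra_simps)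
    finally show ?thesis .
  qed
  thus ?thesis by (simp only: fser_def)
qed

lemma has_integral_reflect_unit:
  fixes f :: "real \<Rightarrow> real"
  assumes "(f has_integral I) {0..1}"
  shows "((\<lambda>x. f (1 - x)) has_integral I) {0..1}"
proof -
  have "((\<lambda>x. f (- x)) has_integral I) {-1..0}"
    using has_integral_reflect_lemma_real[OF assms] by simp
  from has_integral_shift_real_ivl[OF this, of "-1"] show ?thesis
    by simp
qed

text \<open>For z = z' = 0, where no factor has a uniformly convergent expansion; it matches
  (1/pi)^2 / 2 times pi^2 / 6.\<close>

lemma has_integral_quadratic: "((\<lambda>q::real. (1 / 2 - q) * (1 / 2 - q)) has_integral 1 / 12) {0..1}"
proof -
  have "((\<lambda>q::real. (1 / 2 - q) * (1 / 2 - q)) has_integral - ((1 / 2 - 1) ^ 3 / 3) - - ((1 / 2 - 0) ^ 3 / 3)) {0..1}"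
    by (rule fundamental_theorem_of_calculus)
       (auto intro!: derivative_eq_intros simp: power2_eq_square simp flip: has_real_derivative_iff_has_vector_derivative)
  thus ?thesis by (simp add: power3_eq_cube)
qed

lemma zeta_real_2: "zeta_real 2 = pi\<^sup>2 / 6"
proof -
  have "(\<lambda>n. real (Suc n) powr (- 2)) = (\<lambda>n. 1 / (real n + 1)\<^sup>2)"
    by (simp add: powr_minus_divide fun_eq_iff add_ac)
  thus ?thesis
    unfolding zeta_real_def using sums_unique[OF inverse_squares_sums] by (simp add: add_ac)
qed

lemma hz_const_0: "hz_const 0 = 1 / pi"
  by (simp add: hz_const_def)

lemma hz_real_integral:
  assumes "z \<le> 0" "z' \<le> 0"
  shows "((\<lambda>q. hz_real z' q * hz_real z q) has_integral
           hz_const z * hz_const z' / 2 * zeta_real (2 - z - z') * cos (pi * (z - z') / 2)) {0..1}"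
proof -
  have *: "((\<lambda>q. hz_real z' q * hz_real z q) has_integral
           hz_const z * hz_const z' / 2 * zeta_real (2 - z - z') * cos (pi * (z - z') / 2)) {0..1}"
    if "z < 0" "z' \<le> 0" for z z'
  proof -
    have "pi * z' / 2 - pi * z / 2 = - (pi * (z - z') / 2)" by (simp add: field_simps)
    hence "cos (pi * z' / 2 - pi * z / 2) = cos (pi * (z - z') / 2)"
      by (simp only: cos_minus)
    thus ?thesis using hz_real_pairing[OF that, of "pi * z / 2"] that by (simp add: hz_real_def [of z])
  qed
  \<comment> \<open>The expanded factor must have a strictly negative exponent; if z = 0 the roles
    are exchanged, which the even cosine does not notice.\<close>
  consider "z < 0" | "z = 0" "z' < 0" | "z = 0" "z' = 0" using assms by linarith
  thus ?thesis
  proof cases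
    case 2
    have "pi * (z' - z) / 2 = - (pi * (z - z') / 2)" by (simp add: field_simps)
    hence "cos (pi * (z' - z) / 2) = cos (pi * (z - z') / 2)"
      by (simp only: cos_minus)
    thus ?thesis using *[OF 2(2) assms(1)] by (simp add: mult_ac algebra_simps)
  next
    case 3
    thus ?thesis using has_integral_quadratic by (simp add: hz_real_def hz_const_0 zeta_real_2 power2_eq_square)
  qed (use * assms in auto)
qed

lemma hz_real_integral_reflect:
  assumes "z \<le> 0" "z' \<le> 0"
  shows "((\<lambda>q. hz_real z' q * hz_real z (1 - q)) has_integral
           - (hz_const z * hz_const z' / 2 * zeta_real (2 - z - z') * cos (pi * (z + z') / 2))) {0..1}"
proof -
  have *: "((\<lambda>q. hz_real z' q * hz_real z (1 - q)) has_integral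
           - (hz_const z * hz_const z' / 2 * zeta_real (2 - z - z') * cos (pi * (z + z') / 2))) {0..1}"
    if "z < 0" "z' \<le> 0" for z z'
  proof -
    have e: "pi * z' / 2 - (pi - pi * z / 2) = pi * (z + z') / 2 - pi" by (simp add: field_simps)
    have "cos (pi * z' / 2 - (pi - pi * z / 2)) = - cos (pi * (z + z') / 2)"
      unfolding e cos_diff by simp
    thus ?thesis using hz_real_pairing[OF that, of "pi - pi * z / 2"] that
      by (simp add: hz_real_def [of z] fser_reflect)
  qed
  consider "z < 0" | "z = 0" "z' < 0" | "z = 0" "z' = 0" using assms by linarith
  thus ?thesis
  proof cases
    case 2
    \<comment> \<open>Exchanging z and z' puts 1 - q into the wrong factor; the substitution of 1 -
      q for q moves it back.\<close>
    from has_integral_reflect_unit[OF *[OF 2(2) assms(1)]] show ?thesis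
      by (simp add: mult_ac algebra_simps)
  next
    case 3
    have "((\<lambda>q::real. - ((1 / 2 - q) * (1 / 2 - q))) has_integral - (1 / 12)) {0..1}"
      by (rule has_integral_neg[OF has_integral_quadratic])
    also have "(\<lambda>q::real. - ((1 / 2 - q) * (1 / 2 - q))) = (\<lambda>q. (1 / 2 - q) * (1 / 2 - (1 - q)))"
      by (simp add: fun_eq_iff algebra_simps)
    finally show ?thesis using 3 by (simp add: hz_real_def hz_const_0 zeta_real_2 power2_eq_square)
  qed (use * assms in auto)
qed

section \<open>The functional equation and the second forms\<close>

lemma riemann_zeta_dser:
  assumes "Re s < 0"
  shows "dser (\<lambda>_. 1) s = riemann_zeta (1 - s)"
proof -
  have "1 - s \<noteq> 1" "\<not> Re (1 - s) < 0" using assms by auto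
  hence "riemann_zeta (1 - s) = hz_right (1 - s) 1"
    unfolding riemann_zeta_def by (subst hurwitz_zeta_eq) auto
  also have "\<dots> = (\<Sum>n. of_real (real n + 1) powr (- (1 - s)))"
    using hz_right_sums[of "1 - s" 1] assms by (simp add: sums_iff)
  also have "\<dots> = dser (\<lambda>_. 1) s"
    by (simp add: dser_def add_ac)
  finally show ?thesis ..
qed

lemma riemann_zeta_of_real:
  assumes "x > 1"
  shows "riemann_zeta (of_real x) = of_real (zeta_real x)"
  using riemann_zeta_dser[of "of_real (1 - x)"] dser_of_real[of "1 - x" "\<lambda>_. 1"] assms
  by (simp add: zeta_real_def)

lemma riemann_zeta_functional_equation:
  assumes "Re s < 0"
  shows "riemann_zeta s = 2 * Gamma (1 - s) * of_real (2 * pi) powr (s - 1) * sin (of_real pi * s / 2) * riemann_zeta (1 - s)"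
proof -
  have 1: "sin (2 * pi * real (Suc n) * 1) = 0" for n
    using sin_add_period[of "Suc n" 0] by simp
  have 2: "cos (2 * pi * real (Suc n) * 1) = 1" for n
    using sin_add_period[of "Suc n" "pi / 2"] by (simp add: sin_add)
  have "s \<noteq> 1" using assms by auto
  hence "riemann_zeta s = hz_left s 1"
    unfolding riemann_zeta_def using assms by (subst hurwitz_zeta_eq) auto
  thus ?thesis
    unfolding hz_left_def 1 2 riemann_zeta_dser[OF assms, symmetric] by (simp add: dser_def [of "\<lambda>_. 0"])
qed

lemma riemann_zeta_of_real_neg:
  assumes "w < 0"
  shows "riemann_zeta (of_real w) = of_real (hz_const w * sin (pi * w / 2)) * riemann_zeta (of_real (1 - w))"
proof -
  have "sin (of_real pi * of_real w / 2) = complex_of_real (sin (pi * w / 2))"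
    by (simp flip: sin_of_real)
  thus ?thesis
    using riemann_zeta_functional_equation[of "of_real w"] assms
    unfolding of_real_hz_const by simp
qed

text \<open>In the functional equation at w - 1 the sine is -cos(pi w / 2), so the quotient
  coincides with a function \<open>g\<close> holomorphic on Re w < 1, and its limit at a zero of the
  cosine is the value of \<open>g\<close>.\<close>

lemma zeta_over_cos_of_real:
  assumes "w \<le> 0"
  shows "zeta_over_cos (of_real w) = - (of_real (hz_const (w - 1)) * riemann_zeta (of_real (2 - w)))"
proof -
  define g where "g = (\<lambda>w. - (2 * Gamma (2 - w) * of_real (2 * pi) powr (w - 1 - 1) * dser (\<lambda>_. 1) (w - 1)))"
  have op: "open {w. Re w < 1}" by (rule open_halfspace_Re_lt)
  have "g holomorphic_on {w. Re w < 1}"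
    unfolding g_def
  proof (intro holomorphic_intros holomorphic_on_compose_gen[OF _ holomorphic_dser, unfolded o_def])
    show "2 - w \<notin> \<int>\<^sub>\<le>\<^sub>0" if "w \<in> {w. Re w < 1}" for w
      using that by (auto elim!: nonpos_Ints_cases simp: complex_eq_iff)
  qed auto
  hence "isCont g (of_real w)"
    using op assms by (auto dest!: holomorphic_on_imp_continuous_on simp: continuous_on_eq_continuous_at)
  hence lim: "g \<midarrow>of_real w\<rightarrow> g (of_real w)" by (rule isContD)
  have "(\<lambda>w. riemann_zeta (w - 1) / cos (of_real pi * w / 2)) \<midarrow>of_real w\<rightarrow> g (of_real w)"
  proof (rule Lim_transform_eventually[OF lim])
    \<comment> \<open>The zeros of the cosine are isolated: it is entire and equals 1 at 0.\<close>
    have "\<forall>\<^sub>F v in at (complex_of_real w). cos (of_real pi * v / 2) \<noteq> 0 \<and> v \<in> UNIV"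
      by (rule non_zero_neighbour_alt[of _ _ _ 0]) (auto intro!: holomorphic_intros)
    moreover have "\<forall>\<^sub>F v in at (of_real w). v \<in> {v. Re v < 1}"
      using op assms by (intro eventually_at_in_open') auto
    ultimately show "\<forall>\<^sub>F v in at (of_real w). g v = riemann_zeta (v - 1) / cos (of_real pi * v / 2)"
    proof eventually_elim
      case (elim v)
      have e: "of_real pi * (v - 1) / 2 = of_real pi * v / 2 - of_real (pi / 2)" by (simp add: field_simps)
      have "sin (of_real pi * (v - 1) / 2) = - cos (of_real pi * v / 2)"
        unfolding e sin_diff sin_of_real cos_of_real by simp
      moreover have "dser (\<lambda>_. 1) (v - 1) = riemann_zeta (1 - (v - 1))"
        using elim by (intro riemann_zeta_dser) auto
      ultimately show ?case
        using riemann_zeta_functional_equation[of "v - 1"] elim by (simp add: g_def)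
    qed
  qed
  hence "zeta_over_cos (of_real w) = g (of_real w)"
    unfolding zeta_over_cos_def by (rule remove_sings_eqI)
  also have "g (of_real w) = - (2 * Gamma (1 - of_real (w - 1)) * of_real (2 * pi) powr (of_real (w - 1) - 1) * dser (\<lambda>_. 1) (of_real (w - 1)))"
    by (simp add: g_def)
  also have "dser (\<lambda>_. 1) (of_real (w - 1)) = riemann_zeta (1 - of_real (w - 1))"
    using assms by (intro riemann_zeta_dser) auto
  also have "1 - complex_of_real (w - 1) = of_real (2 - w)" by simp
  finally show ?thesis unfolding of_real_hz_const[of "w - 1", symmetric] by simp
qed

text \<open>In the second identity Gamma(2 - z - z') is the numerator in
  \<open>hz_const (z + z' - 1)\<close> and the denominator of Beta, so it cancels.\<close>

lemma hz_const_mult: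
  assumes "z \<le> 0" "z' \<le> 0"
  shows "hz_const z * hz_const z' / 2 = 2 * Gamma (1 - z) * Gamma (1 - z') / (2 * pi) powr (2 - z - z')"
    and "hz_const (z + z' - 1) * Beta (1 - z) (1 - z') = 2 * Gamma (1 - z) * Gamma (1 - z') / (2 * pi) powr (2 - z - z')"
proof -
  have "(2 * pi) powr (2 - z - z') = (2 * pi) powr ((1 - z) + (1 - z'))" by (simp add: algebra_simps)
  also have "\<dots> = (2 * pi) powr (1 - z) * (2 * pi) powr (1 - z')" by (rule powr_add)
  finally show "hz_const z * hz_const z' / 2 = 2 * Gamma (1 - z) * Gamma (1 - z') / (2 * pi) powr (2 - z - z')"
    by (simp add: hz_const_def)
  have "Gamma (2 - z - z') > 0" using assms by (intro Gamma_real_pos) auto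
  thus "hz_const (z + z' - 1) * Beta (1 - z) (1 - z') = 2 * Gamma (1 - z) * Gamma (1 - z') / (2 * pi) powr (2 - z - z')"
    by (simp add: hz_const_def Beta_def algebra_simps)
qed

theorem theorem3p1:
  fixes z z' :: real
  assumes "z \<le> 0" and "z' \<le> 0"
  shows
    "((\<lambda>q. hurwitz_zeta (of_real z') q * hurwitz_zeta (of_real z) q) has_integral
        of_real (2 * Gamma (1 - z) * Gamma (1 - z') / (2 * pi) powr (2 - z - z'))
          * riemann_zeta (of_real (2 - z - z')) * of_real (cos (pi * (z - z') / 2))) {0<..<1}
     \<and>
     of_real (2 * Gamma (1 - z) * Gamma (1 - z') / (2 * pi) powr (2 - z - z'))
       * riemann_zeta (of_real (2 - z - z')) * of_real (cos (pi * (z - z') / 2))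
     = - (zeta_over_cos (of_real (z + z'))
          * of_real (Beta (1 - z) (1 - z')) * of_real (cos (pi * (z - z') / 2)))
     \<and>
     ((\<lambda>q. hurwitz_zeta (of_real z') q * hurwitz_zeta (of_real z) (1 - q)) has_integral
        - (of_real (2 * Gamma (1 - z) * Gamma (1 - z') / (2 * pi) powr (2 - z - z'))
           * riemann_zeta (of_real (2 - z - z')) * of_real (cos (pi * (z + z') / 2)))) {0<..<1}
     \<and>
     - (of_real (2 * Gamma (1 - z) * Gamma (1 - z') / (2 * pi) powr (2 - z - z'))
        * riemann_zeta (of_real (2 - z - z')) * of_real (cos (pi * (z + z') / 2)))
     = riemann_zeta (of_real (z + z' - 1)) * of_real (Beta (1 - z) (1 - z'))"
proof (intro conjI)
  define c where "c = 2 * Gamma (1 - z) * Gamma (1 - z') / (2 * pi) powr (2 - z - z')"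
  have c: "hz_const z * hz_const z' / 2 = c" "hz_const (z + z' - 1) * Beta (1 - z) (1 - z') = c"
    unfolding c_def by (rule hz_const_mult[OF assms])+
  have zeta: "riemann_zeta (of_real (2 - z - z')) = of_real (zeta_real (2 - z - z'))"
    using assms by (intro riemann_zeta_of_real) auto
  show "((\<lambda>q. hurwitz_zeta (of_real z') q * hurwitz_zeta (of_real z) q) has_integral
        of_real c * riemann_zeta (of_real (2 - z - z')) * of_real (cos (pi * (z - z') / 2))) {0<..<1}"
  proof (rule has_integral_eq)
    \<comment> \<open>\<open>hz_real\<close> is identified with the Hurwitz zeta function only for q
      in (0,1], so the real integral is first transferred from the closed to the open
      interval.\<close>
    show "((\<lambda>q. of_real (hz_real z' q * hz_real z q)) has_integral
        of_real c * riemann_zeta (of_real (2 - z - z')) * of_real (cos (pi * (z - z') / 2))) {0<..<1}"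
      using has_integral_of_real[OF hz_real_integral[OF assms], where 'b = complex]
      unfolding c(1) zeta by (simp add: has_integral_Icc_iff_Ioo)
  qed (use assms in \<open>simp add: hurwitz_zeta_of_real\<close>)
  show "((\<lambda>q. hurwitz_zeta (of_real z') q * hurwitz_zeta (of_real z) (1 - q)) has_integral
        - (of_real c * riemann_zeta (of_real (2 - z - z')) * of_real (cos (pi * (z + z') / 2)))) {0<..<1}"
  proof (rule has_integral_eq)
    show "((\<lambda>q. of_real (hz_real z' q * hz_real z (1 - q))) has_integral
        - (of_real c * riemann_zeta (of_real (2 - z - z')) * of_real (cos (pi * (z + z') / 2)))) {0<..<1}"
      using has_integral_of_real[OF hz_real_integral_reflect[OF assms], where 'b = complex]
      unfolding c(1) zeta by (simp add: has_integral_Icc_iff_Ioo)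
  qed (use assms in \<open>simp add: hurwitz_zeta_of_real\<close>)
  have B: "of_real (hz_const (z + z' - 1)) * of_real (Beta (1 - z) (1 - z')) = complex_of_real c"
    unfolding c(2)[symmetric] by simp
  have "zeta_over_cos (of_real (z + z')) = - (of_real (hz_const (z + z' - 1)) * riemann_zeta (of_real (2 - z - z')))"
    using zeta_over_cos_of_real[of "z + z'"] assms by (simp add: diff_diff_eq)
  thus "of_real c * riemann_zeta (of_real (2 - z - z')) * of_real (cos (pi * (z - z') / 2))
     = - (zeta_over_cos (of_real (z + z')) * of_real (Beta (1 - z) (1 - z')) * of_real (cos (pi * (z - z') / 2)))"
    unfolding B [symmetric] by simp
  have e: "pi * (z + z' - 1) / 2 = pi * (z + z') / 2 - pi / 2" "1 - (z + z' - 1) = 2 - z - z'"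
    by (simp_all add: field_simps)
  have s: "sin (pi * (z + z' - 1) / 2) = - cos (pi * (z + z') / 2)"
    unfolding e sin_diff by simp
  have "z + z' - 1 < 0" using assms by simp
  from riemann_zeta_of_real_neg[OF this]
  have "riemann_zeta (of_real (z + z' - 1)) =
      of_real (hz_const (z + z' - 1)) * - of_real (cos (pi * (z + z') / 2)) * riemann_zeta (of_real (2 - z - z'))"
    unfolding s e(2) by simp
  thus "- (of_real c * riemann_zeta (of_real (2 - z - z')) * of_real (cos (pi * (z + z') / 2)))
     = riemann_zeta (of_real (z + z' - 1)) * of_real (Beta (1 - z) (1 - z'))"
    unfolding B [symmetric] by simp
qed

end
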